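(* For all positive integers $k$ and $N$ there are infinitely many totally real multiquadratic fields $K$ of degree $2^k$ over $\mathbb{Q}$ such that $m(K)\geq N$, i.e., every universal totally positive definite quadratic form over $\mathcal{O}_K$ has at least $N$ variables.
   Context: A multiquadratic field is a number field of the form $K=\mathbb{Q}(\sqrt{p_1},\dots,\sqrt{p_k})$ with $k\geq 1$ and $p_1,\dots,p_k\in\mathbb{N}$. For a totally real number field $K$ with ring of integers $\mathcal{O}_K$, an element $\alpha\in K$ is totally positive if $\sigma(\alpha)>0$ for every real embedding $\sigma:K\hookrightarrow\mathbb{R}$; $\mathcal{O}_K^+$ denotes the set of totally positive elements of $\mathcal{O}_K$. An $N$-ary quadratic form over $\mathcal{O}_K$ is $Q(x_1,\dots,x_N)=\sum_{1\leq i\leq j\leq N}a_{ij}x_ix_j$ with all $a_{ij}\in\mathcal{O}_K$ (cross coefficients need not be divisible by $2$). $Q$ is totally positive definite if $\sum_{i\leq j}\sigma(a_{ij})x_ix_j$ is a positive definite real quadratic form for every embedding $\sigma$, and $Q$ is universal if for every $\alpha\in\mathcal{O}_K^+$ there exist $x_1,\dots,x_N\in\mathcal{O}_K$ with $Q(x_1,\dots,x_N)=\alpha$. $m(K)$ denotes the minimal number of variables of a universal totally positive definite quadratic form over $\mathcal{O}_K$. *)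

theory Defs
  imports "HOL-Computational_Algebra.Polynomial" Complex_Main
begin

definition is_real_subfield :: "real set \<Rightarrow> bool" where
  "is_real_subfield S \<longleftrightarrow> 0 \<in> S \<and> 1 \<in> S \<and>
     (\<forall>x\<in>S. \<forall>y\<in>S. x + y \<in> S \<and> x * y \<in> S) \<and>
     (\<forall>x\<in>S. - x \<in> S) \<and> (\<forall>x\<in>S. x \<noteq> 0 \<longrightarrow> inverse x \<in> S)"

definition multiquadratic_field :: "nat list \<Rightarrow> real set" where
  "multiquadratic_field ps =
     \<Inter> {S. is_real_subfield S \<and> (\<forall>p\<in>set ps. sqrt (real p) \<in> S)}"

definition is_multiquadratic :: "real set \<Rightarrow> bool" where
  "is_multiquadratic K \<longleftrightarrow> (\<exists>ps. ps \<noteq> [] \<and> K = multiquadratic_field ps)"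

definition has_degree :: "real set \<Rightarrow> nat \<Rightarrow> bool" where
  "has_degree K d \<longleftrightarrow> (\<exists>b :: nat \<Rightarrow> real.
     (\<forall>i<d. b i \<in> K) \<and>
     (\<forall>c :: nat \<Rightarrow> rat. (\<Sum>i<d. of_rat (c i) * b i) = 0 \<longrightarrow> (\<forall>i<d. c i = 0)) \<and>
     (\<forall>x\<in>K. \<exists>c :: nat \<Rightarrow> rat. x = (\<Sum>i<d. of_rat (c i) * b i)))"

definition complex_embedding :: "real set \<Rightarrow> (real \<Rightarrow> complex) \<Rightarrow> bool" where
  "complex_embedding K \<sigma> \<longleftrightarrow> \<sigma> 1 = 1 \<and>
     (\<forall>x\<in>K. \<forall>y\<in>K. \<sigma> (x + y) = \<sigma> x + \<sigma> y \<and> \<sigma> (x * y) = \<sigma> x * \<sigma> y)"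

definition real_embedding :: "real set \<Rightarrow> (real \<Rightarrow> real) \<Rightarrow> bool" where
  "real_embedding K \<sigma> \<longleftrightarrow> \<sigma> 1 = 1 \<and>
     (\<forall>x\<in>K. \<forall>y\<in>K. \<sigma> (x + y) = \<sigma> x + \<sigma> y \<and> \<sigma> (x * y) = \<sigma> x * \<sigma> y)"

definition totally_real :: "real set \<Rightarrow> bool" where
  "totally_real K \<longleftrightarrow> (\<forall>\<sigma>. complex_embedding K \<sigma> \<longrightarrow> (\<forall>x\<in>K. \<sigma> x \<in> \<real>))"

definition ring_of_integers :: "real set \<Rightarrow> real set" where
  "ring_of_integers K = {x \<in> K. algebraic_int x}"

definition totally_positive :: "real set \<Rightarrow> real \<Rightarrow> bool" where
  "totally_positive K \<alpha> \<longleftrightarrow> \<alpha> \<in> K \<and> (\<forall>\<sigma>. real_embedding K \<sigma> \<longrightarrow> \<sigma> \<alpha> > 0)"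

definition qf_eval :: "(nat \<Rightarrow> nat \<Rightarrow> 'a::comm_ring) \<Rightarrow> nat \<Rightarrow> (nat \<Rightarrow> 'a) \<Rightarrow> 'a" where
  "qf_eval a n x = (\<Sum>i<n. \<Sum>j\<in>{i..<n}. a i j * x i * x j)"

definition form_over_OK :: "real set \<Rightarrow> nat \<Rightarrow> (nat \<Rightarrow> nat \<Rightarrow> real) \<Rightarrow> bool" where
  "form_over_OK K n a \<longleftrightarrow> (\<forall>i<n. \<forall>j<n. i \<le> j \<longrightarrow> a i j \<in> ring_of_integers K)"

definition totally_pos_definite :: "real set \<Rightarrow> nat \<Rightarrow> (nat \<Rightarrow> nat \<Rightarrow> real) \<Rightarrow> bool" where
  "totally_pos_definite K n a \<longleftrightarrow> (\<forall>\<sigma>. real_embedding K \<sigma> \<longrightarrow>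
     (\<forall>x :: nat \<Rightarrow> real. (\<exists>i<n. x i \<noteq> 0) \<longrightarrow> qf_eval (\<lambda>i j. \<sigma> (a i j)) n x > 0))"

definition universal_form :: "real set \<Rightarrow> nat \<Rightarrow> (nat \<Rightarrow> nat \<Rightarrow> real) \<Rightarrow> bool" where
  "universal_form K n a \<longleftrightarrow> (\<forall>\<alpha>. \<alpha> \<in> ring_of_integers K \<and> totally_positive K \<alpha> \<longrightarrow>
     (\<exists>x. (\<forall>i<n. x i \<in> ring_of_integers K) \<and> qf_eval a n x = \<alpha>))"

end

theory Submission
  imports Defs "HOL-Computational_Algebra.Squarefree" "Jordan_Normal_Form.Char_Poly"
begin

text \<open>
  Let \<open>D\<close> be squarefree with \<open>f\<^sup>2 * D = u\<^sup>2 + 1\<close>, let \<open>s = sqrt D\<close> lie in the field \<open>K\<close> of degree \<open>d\<close>,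
  and put \<open>\<delta> = s * (f * s - u)\<close>. Then \<open>\<delta>\<close> is totally positive and the trace of \<open>\<delta> * g\<close> is a
  multiple of \<open>D\<close> for every integer \<open>g\<close> of \<open>K\<close>. The integers \<open>\<alpha> r = (s + r) * (f * s + u)\<close> with
  \<open>r\<^sup>2 < D\<close> are totally positive, and \<open>\<delta> * \<alpha> r = D + r * s\<close> has trace at most \<open>2 * d * D\<close>.
  Suppose a form \<open>Q\<close> in \<open>n\<close> variables represents all \<open>\<alpha> r\<close>. There are at most \<open>l ^ d\<close> residue classes
  modulo \<open>l\<close>, so if \<open>D\<close> is large then two representing vectors are congruent modulo \<open>l\<close>; if \<open>w\<close> is
  their difference divided by \<open>l\<close>, the parallelogram law bounds the trace of \<open>\<delta> * Q w\<close> by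
  \<open>8 * d * D / l\<^sup>2\<close>. As this trace is a positive multiple of \<open>D\<close>, this is absurd when \<open>l\<^sup>2 > 8 * d\<close>.
  Hence \<open>D\<close> is bounded in terms of \<open>n\<close> and \<open>d\<close>.

  Such \<open>D\<close> with a prescribed lower bound are the squarefree parts of \<open>u\<^sup>2 + 1\<close> for suitable \<open>u\<close>.
  They are not divisible by 3, so taking for \<open>l\<close> a power of 3 makes \<open>l\<close> coprime to all radicands, and
  the residue classes can be counted by adjoining one square root at a time.
\<close>

section \<open>Algebraic integers form a ring\<close>

definition int_span :: "real set \<Rightarrow> real set" where
  "int_span V = {\<Sum>v\<in>V. of_int (c v) * v | c. True}"

lemma int_spanI: "x = (\<Sum>v\<in>V. of_int (c v) * v) \<Longrightarrow> x \<in> int_span V"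
  by (auto simp: int_span_def)

lemma int_spanE:
  assumes "x \<in> int_span V"
  obtains c where "x = (\<Sum>v\<in>V. of_int (c v) * v)"
  using assms by (auto simp: int_span_def)

lemma int_span_add:
  assumes "x \<in> int_span V" "y \<in> int_span V"
  shows "x + y \<in> int_span V"
proof -
  obtain c d where "x = (\<Sum>v\<in>V. of_int (c v) * v)" "y = (\<Sum>v\<in>V. of_int (d v) * v)"
    using assms by (auto elim!: int_spanE)
  then show ?thesis
    by (intro int_spanI[where c = "\<lambda>v. c v + d v"]) (simp add: sum.distrib algebra_simps)
qed

lemma int_span_scale:
  assumes "x \<in> int_span V"
  shows "of_int k * x \<in> int_span V"
proof -
  obtain c where "x = (\<Sum>v\<in>V. of_int (c v) * v)"
    using assms by (auto elim!: int_spanE)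
  then show ?thesis
    by (intro int_spanI[where c = "\<lambda>v. k * c v"]) (simp add: sum_distrib_left algebra_simps)
qed

lemma int_span_sum:
  assumes "\<And>i. i \<in> I \<Longrightarrow> f i \<in> int_span V"
  shows "sum f I \<in> int_span V"
proof -
  have "0 \<in> int_span V"
    by (intro int_spanI[where c = "\<lambda>_. 0"]) simp
  with assms show ?thesis
    by (induction I rule: infinite_finite_induct) (auto intro: int_span_add)
qed

lemma int_span_base:
  assumes "finite V" "v \<in> V"
  shows "v \<in> int_span V"
proof (rule int_spanI)
  have "(\<Sum>w\<in>V. of_int (if w = v then 1 else 0) * w) = (\<Sum>w\<in>V. if w = v then w else 0)"
    by (intro sum.cong) auto
  then show "v = (\<Sum>w\<in>V. of_int (if w = v then 1 else 0) * w)"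
    using assms by simp
qed

lemma int_span_mult:
  assumes "\<And>v. v \<in> V \<Longrightarrow> z * v \<in> int_span V" "x \<in> int_span V"
  shows "z * x \<in> int_span V"
proof -
  obtain c where c: "x = (\<Sum>v\<in>V. of_int (c v) * v)"
    using assms(2) by (auto elim!: int_spanE)
  have "(\<Sum>v\<in>V. of_int (c v) * (z * v)) \<in> int_span V"
    by (intro int_span_sum int_span_scale assms(1))
  then show ?thesis
    unfolding c by (simp add: sum_distrib_left mult_ac)
qed

text \<open>Multiplication by \<open>z\<close> on the generators is given by an integer matrix, and
  \<open>z\<close> is an eigenvalue of it, hence a root of its monic integral characteristic
  polynomial.\<close>

lemma algebraic_int_if_stable:
  assumes fin: "finite V" and nz: "w \<in> V" "w \<noteq> 0"
    and stable: "\<And>v. v \<in> V \<Longrightarrow> z * v \<in> int_span V"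
  shows "algebraic_int z"
proof -
  obtain n and g :: "nat \<Rightarrow> real" where g: "bij_betw g {..<n} V"
    using ex_bij_betw_nat_finite[OF fin] by (auto simp: atLeast0LessThan)
  have "\<forall>v\<in>V. \<exists>c. z * v = (\<Sum>w\<in>V. of_int (c w) * w)"
    using stable by (auto elim!: int_spanE)
  then obtain c where c: "\<And>v. v \<in> V \<Longrightarrow> z * v = (\<Sum>w\<in>V. of_int (c v w) * w)"
    by metis
  define M :: "int mat" where "M = Matrix.mat n n (\<lambda>(i, j). c (g i) (g j))"
  define R :: "real mat" where "R = map_mat of_int M"
  have M: "M \<in> carrier_mat n n" and R: "R \<in> carrier_mat n n"
    by (auto simp: M_def R_def)
  \<comment> \<open>The vector of the generators themselves is the eigenvector; it is nonzero
    because \<open>w\<close> is one of its entries.\<close>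
  define x where "x = Matrix.vec n g"
  have "R *\<^sub>v x = z \<cdot>\<^sub>v x"
  proof (rule eq_vecI)
    fix i assume "i < dim_vec (z \<cdot>\<^sub>v x)"
    then have i: "i < n" by (simp add: x_def)
    then have "g i \<in> V" using g by (auto simp: bij_betw_def)
    have "(R *\<^sub>v x) $ i = (\<Sum>j<n. of_int (c (g i) (g j)) * g j)"
      using i by (auto simp: R_def M_def x_def scalar_prod_def atLeast0LessThan intro!: sum.cong)
    also have "\<dots> = z * g i"
      using sum.reindex_bij_betw[OF g, of "\<lambda>w. of_int (c (g i) w) * w"] c[OF \<open>g i \<in> V\<close>] by simp
    finally show "(R *\<^sub>v x) $ i = (z \<cdot>\<^sub>v x) $ i"
      using i by (simp add: x_def)
  qed (auto simp: R_def M_def x_def)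
  moreover have "x \<noteq> 0\<^sub>v n"
  proof
    assume "x = 0\<^sub>v n"
    moreover obtain i where "i < n" "g i = w"
      using g nz(1) by (auto simp: bij_betw_def)
    ultimately show False
      using nz(2) by (metis index_zero_vec(1) index_vec x_def)
  qed
  ultimately have "eigenvalue R z"
    using R unfolding eigenvalue_def eigenvector_def
    by (intro exI[of _ x]) (auto simp: x_def)
  then have "poly (char_poly R) z = 0"
    using eigenvalue_root_char_poly[OF R] by simp
  then have "poly (map_poly of_int (char_poly M)) z = 0"
    by (simp add: R_def of_int_hom.char_poly_hom[OF M])
  moreover have "lead_coeff (char_poly M) = 1"
    using degree_monic_char_poly[OF M] by simp
  ultimately show ?thesis
    by (auto simp: algebraic_int_altdef_ipoly)
qed

lemma algebraic_int_power_reduction: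
  assumes "algebraic_int (x :: real)"
  obtains m and c :: "nat \<Rightarrow> int" where "m > 0" "x ^ m = (\<Sum>k<m. of_int (c k) * x ^ k)"
proof -
  obtain p :: "int poly" where p: "poly (map_poly of_int p) x = 0" "lead_coeff p = 1"
    using assms by (auto simp: algebraic_int_altdef_ipoly)
  define m where "m = degree p"
  have "0 = (\<Sum>k\<le>m. of_int (coeff p k) * x ^ k)"
    using p(1) by (simp add: poly_altdef degree_map_poly coeff_map_poly m_def)
  also have "\<dots> = (\<Sum>k<m. of_int (coeff p k) * x ^ k) + x ^ m"
    using p(2) by (simp add: lessThan_Suc_atMost [symmetric] m_def)
  finally have eq: "(\<Sum>k<m. of_int (coeff p k) * x ^ k) + x ^ m = 0" by simp
  \<comment> \<open>For \<open>m = 0\<close> the relation would read 1 = 0.\<close>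
  then have "m > 0" by (cases m) auto
  moreover have "x ^ m = (\<Sum>k<m. of_int (- coeff p k) * x ^ k)"
    using eq by (simp add: sum_negf)
  ultimately show ?thesis by (rule that)
qed

text \<open>Multiplying by \<open>x\<close> raises the exponent \<open>i\<close> by one; only the
  top exponent \<open>m - 1\<close> overflows, and there the monic relation reduces
  \<open>x ^ m\<close>.\<close>

lemma power_products_stable:
  fixes x y :: real
  assumes m: "m > 0" "x ^ m = (\<Sum>k<m. of_int (c k) * x ^ k)"
    and V: "V = (\<lambda>(i, j). x ^ i * y ^ j) ` ({..<m} \<times> {..<n})"
    and v: "v \<in> V"
  shows "x * v \<in> int_span V"
proof -
  have fin: "finite V" by (simp add: V)
  obtain i j where ij: "i < m" "j < n" "v = x ^ i * y ^ j"
    using v by (auto simp: V)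
  show ?thesis
  proof (cases "Suc i < m")
    case True
    then have "x ^ Suc i * y ^ j \<in> V" using ij by (force simp: V)
    then show ?thesis using int_span_base[OF fin] ij(3) by (simp add: mult_ac)
  next
    case False
    then have "m = Suc i" using ij by simp
    then have "x * v = x ^ m * y ^ j" by (simp add: ij)
    also have "\<dots> = (\<Sum>k<m. of_int (c k) * (x ^ k * y ^ j))"
      unfolding m(2) by (simp add: sum_distrib_left mult_ac)
    also have "\<dots> \<in> int_span V"
    proof (intro int_span_sum int_span_scale int_span_base fin)
      fix k assume "k \<in> {..<m}"
      then show "x ^ k * y ^ j \<in> V" using ij by (force simp: V)
    qed
    finally show ?thesis .
  qed
qed

text \<open>The products of bounded powers of \<open>x\<close> and \<open>y\<close> generate a
  module that is stable under both numbers, hence under their sum and product.\<close>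

lemma
  fixes x y :: real
  assumes "algebraic_int x" "algebraic_int y"
  shows algebraic_int_add: "algebraic_int (x + y)"
    and algebraic_int_mult: "algebraic_int (x * y)"
proof -
  obtain m c where m: "m > 0" "x ^ m = (\<Sum>k<m. of_int (c k) * x ^ k)"
    using algebraic_int_power_reduction[OF assms(1)] by metis
  obtain n d where n: "n > 0" "y ^ n = (\<Sum>k<n. of_int (d k) * y ^ k)"
    using algebraic_int_power_reduction[OF assms(2)] by metis
  define V where "V = (\<lambda>(i, j). x ^ i * y ^ j) ` ({..<m} \<times> {..<n})"
  \<comment> \<open>With the roles of \<open>x\<close> and \<open>y\<close> exchanged, the same set
    serves for multiplication by \<open>y\<close>.\<close>
  have V': "V = (\<lambda>(i, j). y ^ i * x ^ j) ` ({..<n} \<times> {..<m})"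
    by (force simp: V_def mult_ac)
  have fin: "finite V" by (simp add: V_def)
  have "(\<lambda>(i, j). x ^ i * y ^ j) (0, 0) \<in> V"
    unfolding V_def by (intro imageI) (use m n in auto)
  then have one: "1 \<in> V" by simp
  have x: "x * v \<in> int_span V" if "v \<in> V" for v
    using power_products_stable[OF m V_def that] .
  have y: "y * v \<in> int_span V" if "v \<in> V" for v
    using power_products_stable[OF n V' that] .
  have "(x + y) * v \<in> int_span V" if "v \<in> V" for v
    using int_span_add[OF x[OF that] y[OF that]] by (simp add: algebra_simps)
  with algebraic_int_if_stable[OF fin one] show "algebraic_int (x + y)" by simp
  have "(x * y) * v \<in> int_span V" if "v \<in> V" for v
    using int_span_mult[OF x y[OF that]] by (simp add: mult_ac)
  with algebraic_int_if_stable[OF fin one] show "algebraic_int (x * y)" by simp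
qed

lemma algebraic_int_diff:
  fixes x y :: real
  assumes "algebraic_int x" "algebraic_int y"
  shows "algebraic_int (x - y)"
  using algebraic_int_add[of x "- y"] assms by simp

lemma algebraic_int_sum:
  fixes f :: "'a \<Rightarrow> real"
  assumes "\<And>i. i \<in> I \<Longrightarrow> algebraic_int (f i)"
  shows "algebraic_int (sum f I)"
  using assms by (induction I rule: infinite_finite_induct) (auto intro: algebraic_int_add)

section \<open>Real subfields and their embeddings\<close>

locale real_subfield =
  fixes K :: "real set"
  assumes subfield: "is_real_subfield K"
begin

lemma zero_mem [simp, intro]: "0 \<in> K" and one_mem [simp, intro]: "1 \<in> K"
  and add_mem [intro]: "x \<in> K \<Longrightarrow> y \<in> K \<Longrightarrow> x + y \<in> K"
  and mult_mem [intro]: "x \<in> K \<Longrightarrow> y \<in> K \<Longrightarrow> x * y \<in> K"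
  and uminus_mem [intro]: "x \<in> K \<Longrightarrow> - x \<in> K"
  using subfield by (auto simp: is_real_subfield_def)

lemma inverse_mem [intro]: "x \<in> K \<Longrightarrow> inverse x \<in> K"
  using subfield by (cases "x = 0") (auto simp: is_real_subfield_def)

lemma diff_mem [intro]: "x \<in> K \<Longrightarrow> y \<in> K \<Longrightarrow> x - y \<in> K"
  using add_mem[of x "- y"] by auto

lemma divide_mem [intro]: "x \<in> K \<Longrightarrow> y \<in> K \<Longrightarrow> x / y \<in> K"
  by (auto simp: divide_inverse)

lemma of_nat_mem [simp, intro]: "of_nat n \<in> K"
  by (induction n) auto

lemma of_int_mem [simp, intro]: "of_int n \<in> K"
  by (cases n rule: int_cases2) auto

lemma Rats_subset: "\<rat> \<subseteq> K"
  by (auto elim!: Rats_cases' intro!: divide_mem)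

lemma of_rat_mem [simp, intro]: "of_rat q \<in> K"
  using Rats_subset by auto

lemma power_mem [intro]: "x \<in> K \<Longrightarrow> x ^ n \<in> K"
  by (induction n) auto

lemma sum_mem: "(\<And>i. i \<in> I \<Longrightarrow> f i \<in> K) \<Longrightarrow> sum f I \<in> K"
  by (induction I rule: infinite_finite_induct) auto

lemma ring_of_integers_of_int: "of_int n \<in> ring_of_integers K"
  and ring_of_integers_of_nat: "of_nat m \<in> ring_of_integers K"
  by (auto simp: ring_of_integers_def)

lemma ring_of_integers_add:
    "x \<in> ring_of_integers K \<Longrightarrow> y \<in> ring_of_integers K \<Longrightarrow> x + y \<in> ring_of_integers K"
  and ring_of_integers_diff:
    "x \<in> ring_of_integers K \<Longrightarrow> y \<in> ring_of_integers K \<Longrightarrow> x - y \<in> ring_of_integers K"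
  and ring_of_integers_mult:
    "x \<in> ring_of_integers K \<Longrightarrow> y \<in> ring_of_integers K \<Longrightarrow> x * y \<in> ring_of_integers K"
  by (auto simp: ring_of_integers_def algebraic_int_add algebraic_int_diff algebraic_int_mult)

lemma ring_of_integers_sum:
  "(\<And>i. i \<in> I \<Longrightarrow> f i \<in> ring_of_integers K) \<Longrightarrow> sum f I \<in> ring_of_integers K"
  by (auto simp: ring_of_integers_def intro!: algebraic_int_sum sum_mem)

end

text \<open>The target is any field of characteristic 0, so real and complex embeddings are covered
  together.\<close>

locale field_embedding = real_subfield +
  fixes \<sigma> :: "real \<Rightarrow> 'a :: field_char_0"
  assumes hom_one [simp]: "\<sigma> 1 = 1"
    and hom_add: "x \<in> K \<Longrightarrow> y \<in> K \<Longrightarrow> \<sigma> (x + y) = \<sigma> x + \<sigma> y"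
    and hom_mult: "x \<in> K \<Longrightarrow> y \<in> K \<Longrightarrow> \<sigma> (x * y) = \<sigma> x * \<sigma> y"
begin

lemma hom_zero [simp]: "\<sigma> 0 = 0"
  using hom_add[of 0 0] by simp

lemma hom_uminus: "x \<in> K \<Longrightarrow> \<sigma> (- x) = - \<sigma> x"
  using hom_add[of x "- x"] by (auto simp: add_eq_0_iff)

lemma hom_diff: "x \<in> K \<Longrightarrow> y \<in> K \<Longrightarrow> \<sigma> (x - y) = \<sigma> x - \<sigma> y"
  using hom_add[of x "- y"] by (auto simp: hom_uminus)

lemma hom_inverse: "x \<in> K \<Longrightarrow> \<sigma> (inverse x) = inverse (\<sigma> x)"
  using hom_mult[of x "inverse x"] inverse_mem[of x]
  by (cases "x = 0") (auto dest: inverse_unique)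

lemma hom_nonzero: "x \<in> K \<Longrightarrow> x \<noteq> 0 \<Longrightarrow> \<sigma> x \<noteq> 0"
  using hom_mult[of x "inverse x"] inverse_mem[of x] by auto

lemma hom_of_nat [simp]: "\<sigma> (of_nat n) = of_nat n"
  by (induction n) (auto simp: hom_add)

lemma hom_of_int [simp]: "\<sigma> (of_int n) = of_int n"
  by (cases n rule: int_cases2) (auto simp: hom_uminus)

lemma hom_power: "x \<in> K \<Longrightarrow> \<sigma> (x ^ n) = \<sigma> x ^ n"
  by (induction n) (auto simp: hom_mult power_mem)

lemma hom_sum: "(\<And>i. i \<in> I \<Longrightarrow> f i \<in> K) \<Longrightarrow> \<sigma> (sum f I) = (\<Sum>i\<in>I. \<sigma> (f i))"
  by (induction I rule: infinite_finite_induct) (auto simp: hom_add sum_mem)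

text \<open>An embedding fixes integer coefficients, so it maps roots of an integral polynomial to
  roots of the same polynomial.\<close>

lemma hom_algebraic_int:
  assumes "x \<in> K" "algebraic_int x"
  shows "algebraic_int (\<sigma> x)"
proof -
  obtain p :: "int poly" where p: "poly (map_poly of_int p) x = 0" "lead_coeff p = 1"
    using assms by (auto simp: algebraic_int_altdef_ipoly)
  have "poly (map_poly of_int p) (\<sigma> x) = \<sigma> (poly (map_poly of_int p) x)"
    using assms(1)
    by (simp add: poly_altdef degree_map_poly coeff_map_poly hom_sum hom_mult hom_power
        mult_mem power_mem)
  with p show ?thesis
    by (auto simp: algebraic_int_altdef_ipoly)
qed

lemma hom_sqrt:
  assumes "sqrt (real n) \<in> K"
  shows "\<sigma> (sqrt (real n)) * \<sigma> (sqrt (real n)) = of_nat n"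
  using hom_mult[OF assms assms] by simp

lemma hom_qf_eval:
  assumes "\<And>i j. i \<le> j \<Longrightarrow> j < n \<Longrightarrow> a i j \<in> K" "\<And>i. i < n \<Longrightarrow> x i \<in> K"
  shows "\<sigma> (qf_eval a n x) = qf_eval (\<lambda>i j. \<sigma> (a i j)) n (\<lambda>i. \<sigma> (x i))"
proof -
  have mem: "a i j * x i * x j \<in> K" if "i < n" "j \<in> {i..<n}" for i j
    using assms that by (intro mult_mem) auto
  have "\<sigma> (qf_eval a n x) = (\<Sum>i<n. \<Sum>j\<in>{i..<n}. \<sigma> (a i j * x i * x j))"
    unfolding qf_eval_def using mem
    by (subst hom_sum, force intro: sum_mem, intro sum.cong refl, subst hom_sum) auto
  also have "\<dots> = qf_eval (\<lambda>i j. \<sigma> (a i j)) n (\<lambda>i. \<sigma> (x i))"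
    unfolding qf_eval_def using assms by (intro sum.cong refl) (simp add: hom_mult mult_mem)
  finally show ?thesis .
qed

end

lemma (in real_subfield) real_embedding_iff: "real_embedding K \<sigma> \<longleftrightarrow> field_embedding K \<sigma>"
  by (auto simp: real_embedding_def field_embedding_def field_embedding_axioms_def
      real_subfield_axioms)

lemma (in real_subfield) complex_embedding_iff: "complex_embedding K \<sigma> \<longleftrightarrow> field_embedding K \<sigma>"
  by (auto simp: complex_embedding_def field_embedding_def field_embedding_axioms_def
      real_subfield_axioms)

section \<open>Multiquadratic fields as generated subfields\<close>

lemma multiquadratic_field_subset:
  assumes "is_real_subfield S" "\<And>p. p \<in> set ps \<Longrightarrow> sqrt (real p) \<in> S"
  shows "multiquadratic_field ps \<subseteq> S"
  using assms by (auto simp: multiquadratic_field_def)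

lemma sqrt_mem_multiquadratic_field: "p \<in> set ps \<Longrightarrow> sqrt (real p) \<in> multiquadratic_field ps"
  by (auto simp: multiquadratic_field_def)

lemma real_subfield_multiquadratic_field: "real_subfield (multiquadratic_field ps)"
  unfolding real_subfield_def multiquadratic_field_def is_real_subfield_def by auto

lemma multiquadratic_field_Nil: "multiquadratic_field [] = \<rat>"
proof
  show "multiquadratic_field [] \<subseteq> \<rat>"
    by (rule multiquadratic_field_subset) (auto simp: is_real_subfield_def)
  show "\<rat> \<subseteq> multiquadratic_field []"
    by (rule real_subfield.Rats_subset[OF real_subfield_multiquadratic_field])
qed

text \<open>The elements with real image form a subfield. It contains the generators, since the
  image of \<open>sqrt p\<close> has square \<open>p\<close> and is therefore plus or minus the real
  root.\<close>

lemma totally_real_multiquadratic_field: "totally_real (multiquadratic_field ps)"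
  unfolding totally_real_def
proof (intro allI impI)
  let ?K = "multiquadratic_field ps"
  interpret real_subfield ?K by (rule real_subfield_multiquadratic_field)
  fix \<sigma> assume "complex_embedding ?K \<sigma>"
  then interpret field_embedding ?K \<sigma> by (simp add: complex_embedding_iff)
  have "is_real_subfield {x \<in> ?K. \<sigma> x \<in> \<real>}"
    by (auto simp: is_real_subfield_def hom_add hom_mult hom_uminus hom_inverse)
  moreover have "sqrt (real p) \<in> {x \<in> ?K. \<sigma> x \<in> \<real>}" if "p \<in> set ps" for p
  proof -
    have mem: "sqrt (real p) \<in> ?K" by (rule sqrt_mem_multiquadratic_field[OF that])
    have "(\<sigma> (sqrt (real p)))\<^sup>2 = (of_real (sqrt (real p)))\<^sup>2"
      using hom_sqrt[OF mem] by (simp add: power2_eq_square flip: of_real_mult)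
    then show ?thesis
      using mem by (auto simp: power2_eq_iff)
  qed
  ultimately show "\<forall>x\<in>?K. \<sigma> x \<in> \<real>"
    using multiquadratic_field_subset[of "{x \<in> ?K. \<sigma> x \<in> \<real>}" ps] by auto
qed

section \<open>Adjoining a square root\<close>

definition adjoin_sqrt :: "real set \<Rightarrow> nat \<Rightarrow> real set" where
  "adjoin_sqrt K a = {\<alpha> + \<beta> * sqrt (real a) | \<alpha> \<beta>. \<alpha> \<in> K \<and> \<beta> \<in> K}"

lemma (in real_subfield) sqrt_mem_adjoin_sqrt: "sqrt (real a) \<in> adjoin_sqrt K a"
  unfolding adjoin_sqrt_def by (intro CollectI exI[of _ 0] exI[of _ 1]) auto

lemma (in real_subfield) subset_adjoin_sqrt: "K \<subseteq> adjoin_sqrt K a"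
proof
  fix x assume "x \<in> K"
  then show "x \<in> adjoin_sqrt K a"
    unfolding adjoin_sqrt_def by (intro CollectI exI[of _ x] exI[of _ 0]) auto
qed

lemma adjoin_sqrtI: "\<alpha> \<in> K \<Longrightarrow> \<beta> \<in> K \<Longrightarrow> x = \<alpha> + \<beta> * sqrt (real a) \<Longrightarrow> x \<in> adjoin_sqrt K a"
  by (auto simp: adjoin_sqrt_def)

lemma adjoin_sqrtE:
  assumes "x \<in> adjoin_sqrt K a"
  obtains \<alpha> \<beta> where "\<alpha> \<in> K" "\<beta> \<in> K" "x = \<alpha> + \<beta> * sqrt (real a)"
  using assms by (auto simp: adjoin_sqrt_def)

text \<open>Inverses come from rationalising the denominator; if the root already lies in
  \<open>K\<close>, nothing is adjoined.\<close>

lemma (in real_subfield) real_subfield_adjoin_sqrt: "real_subfield (adjoin_sqrt K a)"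
proof (cases "sqrt (real a) \<in> K")
  case True
  then have "adjoin_sqrt K a = K"
    using subset_adjoin_sqrt by (auto elim!: adjoin_sqrtE)
  then show ?thesis by (simp add: real_subfield_axioms)
next
  case False
  let ?s = "sqrt (real a)"
  have ss: "?s * ?s = real a" by simp
  show ?thesis
    unfolding real_subfield_def is_real_subfield_def
  proof (intro conjI ballI impI)
    show "0 \<in> adjoin_sqrt K a" "1 \<in> adjoin_sqrt K a"
      using subset_adjoin_sqrt[of a] zero_mem one_mem by auto
  next
    fix x y assume "x \<in> adjoin_sqrt K a" "y \<in> adjoin_sqrt K a"
    then obtain \<alpha> \<beta> \<gamma> \<delta> where *: "\<alpha> \<in> K" "\<beta> \<in> K" "\<gamma> \<in> K" "\<delta> \<in> K"
      "x = \<alpha> + \<beta> * ?s" "y = \<gamma> + \<delta> * ?s"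
      by (auto elim!: adjoin_sqrtE)
    show "x + y \<in> adjoin_sqrt K a"
      by (rule adjoin_sqrtI[of "\<alpha> + \<gamma>" _ "\<beta> + \<delta>"]) (use * in \<open>auto simp: algebra_simps\<close>)
    have "x * y = \<alpha> * \<gamma> + \<beta> * \<delta> * (?s * ?s) + (\<alpha> * \<delta> + \<beta> * \<gamma>) * ?s"
      using * by (simp add: algebra_simps del: real_sqrt_mult_self)
    then have "x * y = (\<alpha> * \<gamma> + \<beta> * \<delta> * real a) + (\<alpha> * \<delta> + \<beta> * \<gamma>) * ?s"
      by (simp only: ss)
    then show "x * y \<in> adjoin_sqrt K a"
      by (rule adjoin_sqrtI[rotated 2]) (use * in auto)
  next
    fix x assume "x \<in> adjoin_sqrt K a"
    then obtain \<alpha> \<beta> where *: "\<alpha> \<in> K" "\<beta> \<in> K" "x = \<alpha> + \<beta> * ?s"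
      by (auto elim!: adjoin_sqrtE)
    show "- x \<in> adjoin_sqrt K a"
      by (rule adjoin_sqrtI[of "- \<alpha>" _ "- \<beta>"]) (use * in auto)
    assume "x \<noteq> 0"
    \<comment> \<open>A vanishing conjugate would give either \<open>x = 0\<close> or the root as a
      quotient of elements of \<open>K\<close>.\<close>
    have conj: "\<alpha> - \<beta> * ?s \<noteq> 0"
    proof
      assume 0: "\<alpha> - \<beta> * ?s = 0"
      show False
      proof (cases "\<beta> = 0")
        case True
        then show False using 0 * \<open>x \<noteq> 0\<close> by auto
      next
        case False
        then have "?s = \<alpha> / \<beta>" using 0 by (simp add: field_simps)
        then show False using * \<open>?s \<notin> K\<close> by auto
      qed
    qed
    \<comment> \<open>\<open>N\<close> is the relative norm of \<open>x\<close>, which lies in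
      \<open>K\<close>.\<close>
    define N where "N = \<alpha> * \<alpha> - \<beta> * \<beta> * real a"
    have N: "N = x * (\<alpha> - \<beta> * ?s)"
    proof -
      have "x * (\<alpha> - \<beta> * ?s) = \<alpha> * \<alpha> - \<beta> * \<beta> * (?s * ?s)"
        unfolding *(3) by (simp add: algebra_simps del: real_sqrt_mult_self)
      then show ?thesis using ss by (simp add: N_def)
    qed
    then have "inverse x = (\<alpha> - \<beta> * ?s) / N"
      using conj \<open>x \<noteq> 0\<close> unfolding N by (simp add: inverse_eq_divide)
    also have "\<dots> = \<alpha> / N + (- \<beta> / N) * ?s"
      by (simp add: diff_divide_distrib)
    finally have eq: "inverse x = \<alpha> / N + (- \<beta> / N) * ?s" .
    have "N \<in> K" using * by (auto simp: N_def)
    then show "inverse x \<in> adjoin_sqrt K a"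
      using * by (intro adjoin_sqrtI[OF _ _ eq] divide_mem uminus_mem)
  qed
qed

text \<open>This opens the way to induction on the list of radicands, with the rationals as base
  case.\<close>

lemma multiquadratic_field_Cons:
  "multiquadratic_field (a # ps) = adjoin_sqrt (multiquadratic_field ps) a"
proof
  interpret K: real_subfield "multiquadratic_field ps" by (rule real_subfield_multiquadratic_field)
  interpret L: real_subfield "multiquadratic_field (a # ps)"
    by (rule real_subfield_multiquadratic_field)
  have sub: "is_real_subfield (adjoin_sqrt (multiquadratic_field ps) a)"
    using K.real_subfield_adjoin_sqrt by (simp add: real_subfield_def)
  show "multiquadratic_field (a # ps) \<subseteq> adjoin_sqrt (multiquadratic_field ps) a"
    using K.sqrt_mem_adjoin_sqrt[of a] K.subset_adjoin_sqrt[of a]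
    by (intro multiquadratic_field_subset[OF sub]) (auto dest: sqrt_mem_multiquadratic_field)
  have "multiquadratic_field ps \<subseteq> multiquadratic_field (a # ps)"
    by (intro multiquadratic_field_subset L.subfield sqrt_mem_multiquadratic_field) auto
  then show "adjoin_sqrt (multiquadratic_field ps) a \<subseteq> multiquadratic_field (a # ps)"
    by (auto elim!: adjoin_sqrtE intro!: L.add_mem L.mult_mem sqrt_mem_multiquadratic_field)
qed

section \<open>Coordinates and embeddings in a quadratic extension\<close>

locale quadratic_extension = real_subfield +
  fixes a :: nat
  assumes sqrt_notin: "sqrt (real a) \<notin> K"
begin

abbreviation "L \<equiv> adjoin_sqrt K a"
abbreviation "s \<equiv> sqrt (real a)"

lemma a_pos: "a > 0"
  using sqrt_notin by (cases a) auto

lemma coordinates_eq: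
  assumes "\<alpha> \<in> K" "\<beta> \<in> K" "\<gamma> \<in> K" "\<delta> \<in> K" "\<alpha> + \<beta> * s = \<gamma> + \<delta> * s"
  shows "\<alpha> = \<gamma>" "\<beta> = \<delta>"
proof -
  show "\<beta> = \<delta>"
  proof (rule ccontr)
    assume "\<beta> \<noteq> \<delta>"
    then have "s = (\<gamma> - \<alpha>) / (\<beta> - \<delta>)" using assms(5) by (simp add: field_simps)
    then show False using assms sqrt_notin by auto
  qed
  then show "\<alpha> = \<gamma>" using assms(5) by simp
qed

text \<open>For \<open>c\<close> equal to 1 or -1 this is the extension of \<open>\<sigma>\<close>
  that sends \<open>s\<close> to \<open>c * s\<close>. The description is well defined because the
  coordinates of \<open>x\<close> over \<open>K\<close> are unique.\<close>

definition extend :: "(real \<Rightarrow> real) \<Rightarrow> real \<Rightarrow> real \<Rightarrow> real" where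
  "extend \<sigma> c x = (THE y. \<exists>\<alpha>\<in>K. \<exists>\<beta>\<in>K. x = \<alpha> + \<beta> * s \<and> y = \<sigma> \<alpha> + c * s * \<sigma> \<beta>)"

lemma extend_eq:
  assumes "\<alpha> \<in> K" "\<beta> \<in> K"
  shows "extend \<sigma> c (\<alpha> + \<beta> * s) = \<sigma> \<alpha> + c * s * \<sigma> \<beta>"
  unfolding extend_def
proof (rule the_equality)
  show "\<exists>\<alpha>'\<in>K. \<exists>\<beta>'\<in>K. \<alpha> + \<beta> * s = \<alpha>' + \<beta>' * s
      \<and> \<sigma> \<alpha> + c * s * \<sigma> \<beta> = \<sigma> \<alpha>' + c * s * \<sigma> \<beta>'"
    using assms by blast
next
  fix y
  assume "\<exists>\<alpha>'\<in>K. \<exists>\<beta>'\<in>K. \<alpha> + \<beta> * s = \<alpha>' + \<beta>' * s \<and> y = \<sigma> \<alpha>' + c * s * \<sigma> \<beta>'"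
  then obtain \<gamma> \<delta> where *: "\<gamma> \<in> K" "\<delta> \<in> K" "\<alpha> + \<beta> * s = \<gamma> + \<delta> * s"
    "y = \<sigma> \<gamma> + c * s * \<sigma> \<delta>" by blast
  then show "y = \<sigma> \<alpha> + c * s * \<sigma> \<beta>"
    using coordinates_eq[OF assms *(1-3)] by simp
qed

lemma real_embedding_extend:
  assumes \<sigma>: "real_embedding K \<sigma>" and c: "c * c = 1"
  shows "real_embedding L (extend \<sigma> c)"
proof -
  interpret field_embedding K \<sigma> using \<sigma> by (simp add: real_embedding_iff)
  have ss: "s * s = real a" by simp
  show ?thesis
    unfolding real_embedding_def
  proof (intro conjI ballI)
    show "extend \<sigma> c 1 = 1" using extend_eq[of 1 0 \<sigma> c] by simp
  next
    fix x y assume "x \<in> L" "y \<in> L"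
    then obtain \<alpha> \<beta> \<gamma> \<delta> where *: "\<alpha> \<in> K" "\<beta> \<in> K" "\<gamma> \<in> K" "\<delta> \<in> K"
      "x = \<alpha> + \<beta> * s" "y = \<gamma> + \<delta> * s"
      by (auto elim!: adjoin_sqrtE)
    have "extend \<sigma> c (x + y) = extend \<sigma> c ((\<alpha> + \<gamma>) + (\<beta> + \<delta>) * s)"
      using * by (simp add: algebra_simps)
    also have "\<dots> = \<sigma> (\<alpha> + \<gamma>) + c * s * \<sigma> (\<beta> + \<delta>)"
      by (rule extend_eq) (use * in auto)
    also have "\<dots> = extend \<sigma> c x + extend \<sigma> c y"
      using * by (simp add: extend_eq hom_add algebra_simps)
    finally show "extend \<sigma> c (x + y) = extend \<sigma> c x + extend \<sigma> c y" .
    have "x * y = \<alpha> * \<gamma> + \<beta> * \<delta> * (s * s) + (\<alpha> * \<delta> + \<beta> * \<gamma>) * s"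
      using * by (simp add: algebra_simps del: real_sqrt_mult_self)
    then have "extend \<sigma> c (x * y)
        = extend \<sigma> c ((\<alpha> * \<gamma> + \<beta> * \<delta> * real a) + (\<alpha> * \<delta> + \<beta> * \<gamma>) * s)"
      by (simp only: ss)
    also have "\<dots> = \<sigma> (\<alpha> * \<gamma> + \<beta> * \<delta> * real a) + c * s * \<sigma> (\<alpha> * \<delta> + \<beta> * \<gamma>)"
      by (rule extend_eq) (use * in auto)
    also have "\<dots> = \<sigma> \<alpha> * \<sigma> \<gamma> + \<sigma> \<beta> * \<sigma> \<delta> * real a + c * s * (\<sigma> \<alpha> * \<sigma> \<delta> + \<sigma> \<beta> * \<sigma> \<gamma>)"
      using * by (simp add: hom_add hom_mult mult_mem)
    \<comment> \<open>Writing \<open>a\<close> as the square of \<open>c * s\<close> lets the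
      expression factor.\<close>
    also have "\<dots> = \<sigma> \<alpha> * \<sigma> \<gamma> + \<sigma> \<beta> * \<sigma> \<delta> * ((c * c) * (s * s))
        + c * s * (\<sigma> \<alpha> * \<sigma> \<delta> + \<sigma> \<beta> * \<sigma> \<gamma>)"
      by (simp only: ss c mult_1_left)
    also have "\<dots> = (\<sigma> \<alpha> + c * s * \<sigma> \<beta>) * (\<sigma> \<gamma> + c * s * \<sigma> \<delta>)"
      by (simp add: algebra_simps del: real_sqrt_mult_self)
    also have "\<dots> = extend \<sigma> c x * extend \<sigma> c y"
      using * by (simp add: extend_eq)
    finally show "extend \<sigma> c (x * y) = extend \<sigma> c x * extend \<sigma> c y" .
  qed
qed

end

section \<open>Degree, trace and residue classes in a quadratic extension\<close>

lemma sum_lessThan_add: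
  fixes f :: "nat \<Rightarrow> 'a :: comm_monoid_add"
  shows "sum f {..<m + n} = sum f {..<m} + (\<Sum>i<n. f (m + i))"
  by (induction n) (auto simp: add.assoc)

context quadratic_extension
begin

lemma has_degree_adjoin_sqrt:
  assumes "has_degree K d"
  shows "has_degree L (2 * d)"
proof -
  obtain b :: "nat \<Rightarrow> real" where "\<forall>i<d. b i \<in> K"
    "\<forall>c :: nat \<Rightarrow> rat. (\<Sum>i<d. of_rat (c i) * b i) = 0 \<longrightarrow> (\<forall>i<d. c i = 0)"
    "\<forall>x\<in>K. \<exists>c :: nat \<Rightarrow> rat. x = (\<Sum>i<d. of_rat (c i) * b i)"
    using assms unfolding has_degree_def by blast
  then have b: "\<And>i. i < d \<Longrightarrow> b i \<in> K"
    and indep: "\<And>c :: nat \<Rightarrow> rat. (\<Sum>i<d. of_rat (c i) * b i) = 0 \<Longrightarrow> \<forall>i<d. c i = 0"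
    and spans: "\<And>x. x \<in> K \<Longrightarrow> \<exists>c :: nat \<Rightarrow> rat. x = (\<Sum>i<d. of_rat (c i) * b i)"
    by blast+
  \<comment> \<open>The new basis consists of the old one followed by its multiples by
    \<open>s\<close>.\<close>
  define b' where "b' i = (if i < d then b i else b (i - d) * s)" for i
  have sum: "(\<Sum>i<2 * d. of_rat (c i) * b' i)
      = (\<Sum>i<d. of_rat (c i) * b i) + (\<Sum>i<d. of_rat (c (d + i)) * b i) * s" for c :: "nat \<Rightarrow> rat"
    by (simp add: mult_2 sum_lessThan_add b'_def sum_distrib_right mult.assoc)
  have mem: "(\<Sum>i<d. of_rat (c i) * b i) \<in> K" for c :: "nat \<Rightarrow> rat"
    using b by (intro sum_mem) auto
  show ?thesis
    unfolding has_degree_def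
  proof (intro exI[of _ b'] conjI allI impI ballI)
    fix i assume "i < 2 * d"
    show "b' i \<in> L"
    proof (cases "i < d")
      case True
      then show ?thesis
        using b[of i] subset_adjoin_sqrt[of a] by (auto simp: b'_def)
    next
      case False
      then have "b (i - d) \<in> K" using \<open>i < 2 * d\<close> b by simp
      then show ?thesis
        using False by (intro adjoin_sqrtI[of 0 _ "b (i - d)"]) (auto simp: b'_def)
    qed
  next
    fix c :: "nat \<Rightarrow> rat" and i assume "(\<Sum>i<2 * d. of_rat (c i) * b' i) = 0" and i: "i < 2 * d"
    then have "(\<Sum>i<d. of_rat (c i) * b i) + (\<Sum>i<d. of_rat (c (d + i)) * b i) * s = 0 + 0 * s"
      by (simp add: sum)
    from coordinates_eq[OF mem mem zero_mem zero_mem this]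
    have lo: "\<forall>i<d. c i = 0" and hi: "\<forall>i<d. c (d + i) = 0"
      by (auto dest!: indep)
    show "c i = 0"
      using i lo hi[rule_format, of "i - d"] by (cases "i < d") auto
  next
    fix x assume "x \<in> L"
    then obtain \<alpha> \<beta> where *: "\<alpha> \<in> K" "\<beta> \<in> K" "x = \<alpha> + \<beta> * s"
      by (auto elim!: adjoin_sqrtE)
    obtain c1 c2 :: "nat \<Rightarrow> rat" where "\<alpha> = (\<Sum>i<d. of_rat (c1 i) * b i)"
      "\<beta> = (\<Sum>i<d. of_rat (c2 i) * b i)"
      using spans[OF *(1)] spans[OF *(2)] by auto
    then have "x = (\<Sum>i<2 * d. of_rat (if i < d then c1 i else c2 (i - d)) * b' i)"
      using * by (simp add: sum)
    then show "\<exists>c :: nat \<Rightarrow> rat. x = (\<Sum>i<2 * d. of_rat (c i) * b' i)"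
      by (rule exI[of _ "\<lambda>i. if i < d then c1 i else c2 (i - d)"])
  qed
qed

end

text \<open>This models the trace of a field of degree \<open>d\<close> as a rational-valued sum of
  \<open>d\<close> real embeddings.\<close>

definition trace_family :: "real set \<Rightarrow> nat \<Rightarrow> (nat \<Rightarrow> real \<Rightarrow> real) \<Rightarrow> bool" where
  "trace_family K d \<tau> \<longleftrightarrow>
     (\<forall>i<d. real_embedding K (\<tau> i)) \<and> (\<forall>x\<in>K. (\<Sum>i<d. \<tau> i x) \<in> \<rat>)"

text \<open>Each embedding is extended with both signs of \<open>s\<close>; the multiples of
  \<open>s\<close> cancel and twice the old trace of the first coordinate remains.\<close>

lemma (in quadratic_extension) trace_family_adjoin_sqrt:
  assumes "trace_family K d \<tau>"
  shows "\<exists>\<tau>'. trace_family L (2 * d) \<tau>'"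
proof -
  define \<tau>' where "\<tau>' i = (if i < d then extend (\<tau> i) 1 else extend (\<tau> (i - d)) (- 1))" for i
  have "real_embedding L (\<tau>' i)" if "i < 2 * d" for i
    using that assms by (auto simp: \<tau>'_def trace_family_def intro!: real_embedding_extend)
  moreover have "(\<Sum>i<2 * d. \<tau>' i x) \<in> \<rat>" if x: "x \<in> L" for x
  proof -
    obtain \<alpha> \<beta> where *: "\<alpha> \<in> K" "\<beta> \<in> K" "x = \<alpha> + \<beta> * s"
      using x by (auto elim!: adjoin_sqrtE)
    have "(\<Sum>i<2 * d. \<tau>' i x) = (\<Sum>i<d. extend (\<tau> i) 1 x) + (\<Sum>i<d. extend (\<tau> i) (- 1) x)"
      by (simp add: mult_2 sum_lessThan_add \<tau>'_def)
    also have "\<dots> = (\<Sum>i<d. 2 * \<tau> i \<alpha>)"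
      unfolding sum.distrib [symmetric] using * by (intro sum.cong refl) (simp add: extend_eq)
    finally have "(\<Sum>i<2 * d. \<tau>' i x) = 2 * (\<Sum>i<d. \<tau> i \<alpha>)"
      by (simp add: sum_distrib_left)
    moreover have "(\<Sum>i<d. \<tau> i \<alpha>) \<in> \<rat>"
      using assms * by (auto simp: trace_family_def)
    ultimately show ?thesis by simp
  qed
  ultimately show ?thesis by (auto simp: trace_family_def)
qed

text \<open>This encodes that the ring of integers has at most \<open>c\<close> classes modulo
  \<open>l\<close>: equal labels below \<open>c\<close> force congruence modulo
  \<open>l\<close>.\<close>

definition has_residue_map :: "real set \<Rightarrow> nat \<Rightarrow> nat \<Rightarrow> bool" where
  "has_residue_map K l c \<longleftrightarrow> (\<exists>f :: real \<Rightarrow> nat.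
     (\<forall>x\<in>ring_of_integers K. f x < c) \<and>
     (\<forall>x\<in>ring_of_integers K. \<forall>y\<in>ring_of_integers K. f x = f y \<longrightarrow>
        (\<exists>w\<in>ring_of_integers K. x - y = real l * w)))"

context quadratic_extension
begin

text \<open>
  An integer \<open>x = \<alpha> + \<beta> * s\<close> of \<open>L\<close> satisfies \<open>2 * a * x = A + B * s\<close> where \<open>A = 2 * a * \<alpha>\<close> and
  \<open>B = 2 * a * \<beta>\<close> are integers of \<open>K\<close>, because the sum and the difference of \<open>x\<close> and its
  conjugate are integers.
\<close>

lemma integral_coordinates:
  assumes "x \<in> ring_of_integers L"
  obtains A B where "A \<in> ring_of_integers K" "B \<in> ring_of_integers K"
    "real (2 * a) * x = A + B * s"
proof -
  have x: "x \<in> L" "algebraic_int x" using assms by (auto simp: ring_of_integers_def)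
  obtain \<alpha> \<beta> where *: "\<alpha> \<in> K" "\<beta> \<in> K" "x = \<alpha> + \<beta> * s"
    using x(1) by (auto elim!: adjoin_sqrtE)
  interpret L: real_subfield L by (rule real_subfield_adjoin_sqrt)
  have "real_embedding K (\<lambda>x. x)" by (simp add: real_embedding_def)
  then have "real_embedding L (extend (\<lambda>x. x) (- 1))"
    by (rule real_embedding_extend) simp
  then interpret conj: field_embedding L "extend (\<lambda>x. x) (- 1)"
    by (simp add: L.real_embedding_iff)
  have cx: "extend (\<lambda>x. x) (- 1) x = \<alpha> - \<beta> * s"
    using * extend_eq[of \<alpha> \<beta> "\<lambda>x. x" "- 1"] by simp
  have conj_int: "algebraic_int (\<alpha> - \<beta> * s)"
    using conj.hom_algebraic_int[OF x] cx by simp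
  have s_int: "algebraic_int s" by (intro algebraic_int_sqrt) simp
  show ?thesis
  proof
    have "algebraic_int (real a * (x + (\<alpha> - \<beta> * s)))"
      by (intro algebraic_int_mult algebraic_int_add x conj_int) simp
    moreover have "real a * (x + (\<alpha> - \<beta> * s)) = real (2 * a) * \<alpha>" using * by simp
    moreover have "real (2 * a) * \<alpha> \<in> K" using * by (intro mult_mem of_nat_mem)
    ultimately show "real (2 * a) * \<alpha> \<in> ring_of_integers K"
      by (simp add: ring_of_integers_def)
    \<comment> \<open>The difference from the conjugate is a multiple of \<open>s\<close>; a further
      factor \<open>s\<close> brings it into \<open>K\<close> and keeps it integral.\<close>
    have "(x - (\<alpha> - \<beta> * s)) * s = 2 * \<beta> * (s * s)"
      using * by (simp add: algebra_simps del: real_sqrt_mult_self)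
    then have "(x - (\<alpha> - \<beta> * s)) * s = real (2 * a) * \<beta>" by simp
    moreover have "algebraic_int ((x - (\<alpha> - \<beta> * s)) * s)"
      by (intro algebraic_int_mult algebraic_int_diff x conj_int s_int)
    moreover have "real (2 * a) * \<beta> \<in> K" using * by (intro mult_mem of_nat_mem)
    ultimately show "real (2 * a) * \<beta> \<in> ring_of_integers K"
      by (simp add: ring_of_integers_def)
    show "real (2 * a) * x = real (2 * a) * \<alpha> + real (2 * a) * \<beta> * s"
      using * by (simp add: algebra_simps)
  qed
qed

text \<open>The classes of the two coordinates \<open>A\<close> and \<open>B\<close> determine
  \<open>2 * a * x\<close> modulo \<open>l\<close>, and \<open>2 * a\<close> is invertible modulo
  \<open>l\<close>.\<close>

lemma has_residue_map_adjoin_sqrt: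
  assumes K: "has_residue_map K l c" and l: "l > 0" "coprime l (2 * a)"
  shows "has_residue_map L l (c * c)"
proof -
  interpret L: real_subfield L by (rule real_subfield_adjoin_sqrt)
  obtain f :: "real \<Rightarrow> nat" where f: "\<And>x. x \<in> ring_of_integers K \<Longrightarrow> f x < c"
    and eqD: "\<And>x y. x \<in> ring_of_integers K \<Longrightarrow> y \<in> ring_of_integers K \<Longrightarrow> f x = f y \<Longrightarrow>
      \<exists>w\<in>ring_of_integers K. x - y = real l * w"
    using K unfolding has_residue_map_def by blast
  have "\<forall>x\<in>ring_of_integers L. \<exists>A B. A \<in> ring_of_integers K \<and> B \<in> ring_of_integers K \<and>
      real (2 * a) * x = A + B * s"
    using integral_coordinates by metis
  then obtain A B where AB: "\<And>x. x \<in> ring_of_integers L \<Longrightarrow>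
      A x \<in> ring_of_integers K \<and> B x \<in> ring_of_integers K \<and> real (2 * a) * x = A x + B x * s"
    by metis
  \<comment> \<open>The two labels are packed as the digits of a number in base
    \<open>c\<close>.\<close>
  define g where "g x = f (A x) * c + f (B x)" for x
  have "g x < c * c" if "x \<in> ring_of_integers L" for x
  proof -
    have "f (A x) < c" "f (B x) < c" using AB[OF that] f by auto
    then have "f (A x) * c + f (B x) < f (A x) * c + c" by simp
    also have "\<dots> = Suc (f (A x)) * c" by simp
    also have "\<dots> \<le> c * c" using \<open>f (A x) < c\<close> by (intro mult_right_mono) auto
    finally show ?thesis by (simp add: g_def)
  qed
  moreover have "\<exists>w\<in>ring_of_integers L. x - y = real l * w"
    if xy: "x \<in> ring_of_integers L" "y \<in> ring_of_integers L" and "g x = g y" for x y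
  proof -
    note x = AB[OF xy(1)] and y = AB[OF xy(2)]
    have lt: "f (B x) < c" "f (B y) < c" using x y f by auto
    have "f (A x) = g x div c" "f (A y) = g y div c" "f (B x) = g x mod c" "f (B y) = g y mod c"
      using lt by (simp_all add: g_def)
    then have "f (A x) = f (A y)" "f (B x) = f (B y)" using \<open>g x = g y\<close> by simp_all
    then obtain w1 w2 where w: "w1 \<in> ring_of_integers K" "w2 \<in> ring_of_integers K"
      "A x - A y = real l * w1" "B x - B y = real l * w2"
      using eqD x y by metis
    obtain u v where "u * int (2 * a) + v * int l = gcd (int (2 * a)) (int l)"
      using bezout_int by blast
    also have "gcd (int (2 * a)) (int l) = 1"
      using l(2) by (metis coprime_commute coprime_imp_gcd_eq_1 coprime_int_iff)
    finally have "real_of_int (u * int (2 * a) + v * int l) = 1" by simp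
    then have bezout: "of_int u * real (2 * a) + of_int v * real l = 1" by simp
    have diff: "real (2 * a) * (x - y) = real l * (w1 + w2 * s)"
    proof -
      have "real (2 * a) * (x - y) = (A x - A y) + (B x - B y) * s"
        using x y by (simp add: algebra_simps)
      also have "\<dots> = real l * (w1 + w2 * s)"
        unfolding w by (simp add: algebra_simps)
      finally show ?thesis .
    qed
    \<comment> \<open>The Bezout identity multiplied by \<open>x - y\<close>, with \<open>l\<close>
      factored out, yields this quotient.\<close>
    define z where "z = of_int u * (w1 + w2 * s) + of_int v * (x - y)"
    have "x - y = (of_int u * real (2 * a) + of_int v * real l) * (x - y)"
      using bezout by simp
    also have "\<dots> = of_int u * (real (2 * a) * (x - y)) + real l * (of_int v * (x - y))"
      by (simp only: ring_distribs mult_ac)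
    also have "\<dots> = real l * z"
      unfolding diff z_def by (simp add: algebra_simps)
    finally have "x - y = real l * z" .
    moreover have "ring_of_integers K \<subseteq> ring_of_integers L"
      using subset_adjoin_sqrt by (auto simp: ring_of_integers_def)
    moreover have "s \<in> ring_of_integers L"
      using sqrt_mem_adjoin_sqrt by (auto simp: ring_of_integers_def)
    ultimately show ?thesis
      using w(1,2) xy unfolding z_def
      by (intro bexI[of _ z])
         (auto simp: z_def intro!: L.ring_of_integers_add L.ring_of_integers_mult
            L.ring_of_integers_diff L.ring_of_integers_of_int)
  qed
  ultimately show ?thesis unfolding has_residue_map_def by blast
qed

end

section \<open>Multiquadratic fields of full degree\<close>

text \<open>In \<open>a^2 = m * b^2\<close> the prime \<open>p\<close> would occur to an even power
  on the left and to an odd power on the right.\<close>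

lemma sqrt_notin_Rats:
  assumes "prime p" "odd (multiplicity p (m :: nat))"
  shows "sqrt (real m) \<notin> \<rat>"
proof
  assume "sqrt (real m) \<in> \<rat>"
  then obtain a b :: nat where ab: "b \<noteq> 0" "\<bar>sqrt (real m)\<bar> = real a / real b"
    by (rule Rats_abs_nat_div_natE)
  have m: "m \<noteq> 0" using assms(2) by (intro notI) simp
  have "real a = sqrt (real m) * real b" using ab by simp
  then have "(real a)\<^sup>2 = real m * (real b)\<^sup>2" by (simp add: power_mult_distrib)
  then have eq: "a\<^sup>2 = m * b\<^sup>2" by (simp flip: of_nat_power of_nat_mult)
  with m ab(1) have "a \<noteq> 0" by (intro notI) simp
  have "multiplicity p (a\<^sup>2) = multiplicity p m + multiplicity p (b\<^sup>2)"
    unfolding eq using assms m ab by (intro prime_elem_multiplicity_mult_distrib) auto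
  then have "2 * multiplicity p a = multiplicity p m + 2 * multiplicity p b"
    using assms \<open>a \<noteq> 0\<close> ab by (simp add: prime_elem_multiplicity_power_distrib)
  then show False using assms(2) by presburger
qed

text \<open>
  If \<open>sqrt m = \<alpha> + \<beta> * sqrt a\<close> over a field not containing \<open>sqrt a\<close>, then \<open>\<alpha> * \<beta> = 0\<close>, so \<open>sqrt m\<close>
  or \<open>sqrt (m * a)\<close> already lies in the smaller field.
\<close>

lemma sqrt_notin_multiquadratic_field:
  assumes "prime p" "odd (multiplicity p m)" "\<And>a. a \<in> set ps \<Longrightarrow> a = 0 \<or> \<not> p dvd a"
  shows "sqrt (real m) \<notin> multiquadratic_field ps"
  using assms(2,3)
\<comment> \<open>\<open>m\<close> is generalised because the case \<open>\<alpha> = 0\<close>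
  applies the induction hypothesis to \<open>m * a\<close>.\<close>
proof (induction ps arbitrary: m)
  case Nil
  then show ?case
    using sqrt_notin_Rats[OF assms(1)] by (simp add: multiquadratic_field_Nil)
next
  case (Cons a ps)
  let ?K = "multiquadratic_field ps"
  interpret real_subfield ?K by (rule real_subfield_multiquadratic_field)
  have IH: "sqrt (real n) \<notin> ?K" if "odd (multiplicity p n)" for n
    using Cons.IH[OF that] Cons.prems(2) by simp
  show ?case
  proof
    assume "sqrt (real m) \<in> multiquadratic_field (a # ps)"
    then obtain \<alpha> \<beta> where *: "\<alpha> \<in> ?K" "\<beta> \<in> ?K" "sqrt (real m) = \<alpha> + \<beta> * sqrt (real a)"
      by (auto simp: multiquadratic_field_Cons elim!: adjoin_sqrtE)
    have notin: "sqrt (real m) \<notin> ?K" by (rule IH[OF Cons.prems(1)])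
    then have "sqrt (real a) \<notin> ?K" using * by auto
    then interpret quadratic_extension ?K a by unfold_locales
    have "real m = (\<alpha> + \<beta> * s) * (\<alpha> + \<beta> * s)"
      unfolding *(3) [symmetric] by simp
    also have "\<dots> = \<alpha> * \<alpha> + \<beta> * \<beta> * (s * s) + 2 * \<alpha> * \<beta> * s"
      by (simp add: algebra_simps del: real_sqrt_mult_self)
    also have "\<dots> = (\<alpha> * \<alpha> + \<beta> * \<beta> * real a) + (2 * \<alpha> * \<beta>) * s" by simp
    finally have "(\<alpha> * \<alpha> + \<beta> * \<beta> * real a) + (real 2 * \<alpha> * \<beta>) * s = real m + 0 * s" by simp
    then have "real 2 * \<alpha> * \<beta> = 0"
      by (rule coordinates_eq(2)[rotated -1]) (use * in \<open>blast+\<close>)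
    then consider "\<beta> = 0" | "\<alpha> = 0" by auto
    then show False
    proof cases
      case 1
      then show ?thesis using * notin by simp
    next
      case 2
      \<comment> \<open>Since \<open>a\<close> is nonzero, \<open>p\<close> does not divide it, so
        \<open>m * a\<close> inherits the odd multiplicity of \<open>m\<close>.\<close>
      have m: "m \<noteq> 0" using Cons.prems(1) by (intro notI) simp
      have "\<not> p dvd a" using Cons.prems(2)[of a] a_pos by auto
      then have "multiplicity p (m * a) = multiplicity p m"
        using assms(1) m a_pos
        by (simp add: prime_elem_multiplicity_mult_distrib not_dvd_imp_multiplicity_0)
      then have "sqrt (real (m * a)) \<notin> ?K"
        using Cons.prems(1) by (intro IH) simp
      moreover have "sqrt (real (m * a)) = \<beta> * real a"
        using * 2 by (simp add: real_sqrt_mult)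
      ultimately show ?thesis using * by auto
    qed
  qed
qed

text \<open>Adjoining the roots one by one from the end of the list gives a proper extension, hence
  a doubling of the degree, at every step.\<close>

fun sqrt_independent :: "nat list \<Rightarrow> bool" where
  "sqrt_independent [] \<longleftrightarrow> True"
| "sqrt_independent (a # ps) \<longleftrightarrow> sqrt (real a) \<notin> multiquadratic_field ps \<and> sqrt_independent ps"

lemma has_degree_multiquadratic_field:
  "sqrt_independent ps \<Longrightarrow> has_degree (multiquadratic_field ps) (2 ^ length ps)"
proof (induction ps)
  case Nil
  have "has_degree \<rat> 1"
    unfolding has_degree_def
  proof (intro exI[of _ "\<lambda>_ :: nat. 1 :: real"] conjI ballI)
    fix x :: real assume "x \<in> \<rat>"
    then obtain q where "x = of_rat q" by (auto elim: Rats_cases)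
    then show "\<exists>c :: nat \<Rightarrow> rat. x = (\<Sum>i<1. of_rat (c i) * 1)"
      by (intro exI[of _ "\<lambda>_ :: nat. q"]) simp
  qed auto
  then show ?case by (simp add: multiquadratic_field_Nil)
next
  case (Cons a ps)
  interpret quadratic_extension "multiquadratic_field ps" a
    using Cons.prems real_subfield_multiquadratic_field
    by (simp add: quadratic_extension_def quadratic_extension_axioms_def)
  show ?case
    using Cons by (auto simp: multiquadratic_field_Cons intro: has_degree_adjoin_sqrt)
qed

lemma trace_family_multiquadratic_field:
  "sqrt_independent ps \<Longrightarrow> \<exists>\<tau>. trace_family (multiquadratic_field ps) (2 ^ length ps) \<tau>"
proof (induction ps)
  case Nil
  have "trace_family \<rat> 1 (\<lambda>_ x. x)"
    by (auto simp: trace_family_def real_embedding_def)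
  then show ?case by (auto simp: multiquadratic_field_Nil)
next
  case (Cons a ps)
  interpret quadratic_extension "multiquadratic_field ps" a
    using Cons.prems real_subfield_multiquadratic_field
    by (simp add: quadratic_extension_def quadratic_extension_axioms_def)
  show ?case
    using Cons by (auto simp: multiquadratic_field_Cons intro: trace_family_adjoin_sqrt)
qed

lemma has_residue_map_Rats:
  assumes "l > 0"
  shows "has_residue_map \<rat> l l"
proof -
  have Ints: "ring_of_integers \<rat> = \<int>"
    by (auto simp: ring_of_integers_def intro: rational_algebraic_int_is_int int_imp_algebraic_int
        dest: Ints_subset_Rats[THEN subsetD])
  define f where "f x = nat (\<lfloor>x\<rfloor> mod int l)" for x :: real
  have "f x < l" for x
    using assms by (simp add: f_def nat_less_iff)
  moreover have "\<exists>w\<in>\<int>. x - y = real l * w" if "x \<in> \<int>" "y \<in> \<int>" "f x = f y" for x y :: real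
  proof -
    obtain i j where ij: "x = of_int i" "y = of_int j"
      using \<open>x \<in> \<int>\<close> \<open>y \<in> \<int>\<close> by (auto elim!: Ints_cases)
    have "i mod int l = j mod int l"
      using \<open>f x = f y\<close> assms by (simp add: f_def ij eq_nat_nat_iff)
    then have "int l dvd i - j" by (simp add: mod_eq_dvd_iff)
    then obtain k where "i - j = int l * k" by (auto elim: dvdE)
    then have "x - y = real l * of_int k"
      unfolding ij by (metis of_int_diff of_int_mult of_int_of_nat_eq)
    then show ?thesis by auto
  qed
  ultimately show ?thesis
    unfolding has_residue_map_def Ints by blast
qed

text \<open>Each adjunction squares the number of labels, just as doubling the degree squares
  \<open>l ^ d\<close>.\<close>

lemma has_residue_map_multiquadratic_field:
  assumes "l > 0"
  shows "sqrt_independent ps \<Longrightarrow> (\<And>a. a \<in> set ps \<Longrightarrow> coprime l (2 * a)) \<Longrightarrow>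
    has_residue_map (multiquadratic_field ps) l (l ^ 2 ^ length ps)"
proof (induction ps)
  case Nil
  then show ?case
    using has_residue_map_Rats[OF assms] by (simp add: multiquadratic_field_Nil)
next
  case (Cons a ps)
  interpret quadratic_extension "multiquadratic_field ps" a
    using Cons.prems real_subfield_multiquadratic_field
    by (simp add: quadratic_extension_def quadratic_extension_axioms_def)
  have "has_residue_map (multiquadratic_field ps) l (l ^ 2 ^ length ps)"
    using Cons.prems by (intro Cons.IH) auto
  from has_residue_map_adjoin_sqrt[OF this assms]
  have "has_residue_map L l (l ^ 2 ^ length ps * l ^ 2 ^ length ps)"
    using Cons.prems(2)[of a] by simp
  then show ?case
    by (simp add: multiquadratic_field_Cons mult_2 flip: power_add)
qed

section \<open>Squarefree radicands with a negative Pell solution\<close>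

text \<open>A prime factor of a squared factorial plus one is large. If its square divides too,
  shifting \<open>u\<close> by \<open>p\<close> destroys this while keeping divisibility by
  \<open>p\<close>.\<close>

lemma ex_prime_dvd_square_plus_one:
  "\<exists>p u :: nat. prime p \<and> M < p \<and> p dvd u\<^sup>2 + 1 \<and> \<not> p\<^sup>2 dvd u\<^sup>2 + 1"
proof -
  define u :: nat where "u = fact (M + 2)"
  have "u \<noteq> 0" by (simp add: u_def)
  then have "u\<^sup>2 + 1 \<noteq> 1" by simp
  then obtain p where p: "prime p" "p dvd u\<^sup>2 + 1"
    by (meson prime_factor_nat)
  have pu: "\<not> p dvd u"
  proof
    assume "p dvd u"
    then have "p dvd u\<^sup>2" by (simp add: power2_eq_square)
    then have "p dvd 1" using p(2) by (simp only: dvd_add_right_iff)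
    then show False using p(1) by simp
  qed
  \<comment> \<open>The summand 2 also makes \<open>p\<close> odd.\<close>
  then have big: "M + 2 < p" unfolding u_def prime_dvd_fact_iff[OF p(1)] by simp
  show ?thesis
  proof (cases "p\<^sup>2 dvd u\<^sup>2 + 1")
    case False
    then show ?thesis using p big by (intro exI[of _ p] exI[of _ u]) auto
  next
    case True
    \<comment> \<open>Modulo \<open>p^2\<close> the shift changes the value by
      \<open>2 * u * p\<close>, which is nonzero there as \<open>p\<close> is odd and prime to
      \<open>u\<close>.\<close>
    have eq: "(u + p)\<^sup>2 + 1 = (u\<^sup>2 + 1) + p\<^sup>2 + p * (2 * u)"
      by (simp add: power2_eq_square algebra_simps)
    have "p dvd (u + p)\<^sup>2 + 1"
      unfolding eq by (rule dvd_add[OF dvd_add[OF p(2)]]) (simp_all add: power2_eq_square)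
    moreover have "\<not> p\<^sup>2 dvd (u + p)\<^sup>2 + 1"
    proof
      assume "p\<^sup>2 dvd (u + p)\<^sup>2 + 1"
      moreover have "p\<^sup>2 dvd (u\<^sup>2 + 1) + p\<^sup>2" by (rule dvd_add[OF True]) simp
      ultimately have "p\<^sup>2 dvd p * (2 * u)"
        unfolding eq by (simp only: dvd_add_right_iff)
      then have "p dvd 2 * u"
        using p(1) by (simp add: power2_eq_square)
      then have "p dvd 2" using pu p(1) by (simp add: prime_dvd_mult_iff)
      then show False using big by (auto dest: dvd_imp_le)
    qed
    ultimately show ?thesis
      using p(1) big by (intro exI[of _ p] exI[of _ "u + p"]) auto
  qed
qed

text \<open>-1 is not a square modulo 3.\<close>

lemma not_3_dvd_square_plus_one: "\<not> 3 dvd (u :: nat)\<^sup>2 + 1"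
proof -
  have "u mod 3 = 0 \<or> u mod 3 = 1 \<or> u mod 3 = 2" by presburger
  then have "(u\<^sup>2 + 1) mod 3 \<noteq> 0"
    by (auto simp: power2_eq_square mod_Suc mod_mult_eq [symmetric, of u u])
  then show ?thesis by (simp add: dvd_eq_mod_eq_0)
qed

text \<open>\<open>D\<close> is the squarefree part of \<open>u^2 + 1\<close>. The large prime
  \<open>p\<close> makes \<open>D\<close> large and its root independent of the roots of radicands
  up to \<open>M\<close>.\<close>

lemma ex_negative_pell_radicand:
  "\<exists>D f u p :: nat. squarefree D \<and> f\<^sup>2 * D = u\<^sup>2 + 1 \<and> \<not> 3 dvd D \<and>
     prime p \<and> M < p \<and> p dvd D"
proof -
  obtain p u :: nat where p: "prime p" "M < p" "p dvd u\<^sup>2 + 1" "\<not> p\<^sup>2 dvd u\<^sup>2 + 1"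
    using ex_prime_dvd_square_plus_one by blast
  define D f where "D = squarefree_part (u\<^sup>2 + 1)" and "f = square_part (u\<^sup>2 + 1)"
  have n: "u\<^sup>2 + 1 = D * f\<^sup>2"
    unfolding D_def f_def by (rule squarefree_decompose)
  have "p dvd D"
  \<comment> \<open>A prime factor lost from \<open>D\<close> would divide \<open>f\<close>, so its
    square would divide \<open>u^2 + 1\<close>, against the choice of \<open>p\<close>.\<close>
  proof (rule ccontr)
    assume "\<not> p dvd D"
    then have "p dvd f\<^sup>2" using p(1,3) unfolding n by (simp add: prime_dvd_mult_iff)
    with p(1) have "p dvd f" by (rule prime_dvd_power)
    then have "p\<^sup>2 dvd D * f\<^sup>2" by (simp add: dvd_power_same)
    then show False using p(4) n by simp
  qed
  moreover have "\<not> 3 dvd D"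
    using not_3_dvd_square_plus_one[of u] unfolding n by auto
  moreover have "squarefree D" by (simp add: D_def)
  ultimately show ?thesis
    using p n by (intro exI[of _ D] exI[of _ f] exI[of _ u] exI[of _ p]) (simp add: mult.commute)
qed

lemma odd_multiplicity_squarefree:
  assumes "squarefree (D :: nat)" "prime p" "p dvd D"
  shows "odd (multiplicity p D)"
proof -
  have "D \<noteq> 0" using assms(1) by (intro notI) simp
  with assms have "multiplicity p D \<le> 1"
    by (simp add: squarefree_factorial_semiring'')
  moreover have "multiplicity p D > 0"
    using assms \<open>D \<noteq> 0\<close> by (simp add: prime_multiplicity_gt_zero_iff)
  ultimately have "multiplicity p D = 1" by simp
  then show ?thesis by simp
qed

lemma squarefree_dvd_square:
  assumes "squarefree (D :: nat)" "D dvd t\<^sup>2"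
  shows "D dvd t"
proof (cases "t = 0")
  case False
  have "D \<noteq> 0" using assms(1) by (intro notI) simp
  show ?thesis
  proof (rule multiplicity_le_imp_dvd[OF \<open>D \<noteq> 0\<close>])
    fix p :: nat assume p: "prime p"
    show "multiplicity p D \<le> multiplicity p t"
    proof (cases "p dvd D")
      case True
      then have "p dvd t\<^sup>2" using assms(2) by (rule dvd_trans)
      then have "p dvd t" using p by (metis prime_dvd_power)
      then have "multiplicity p t > 0"
        using p False by (simp add: prime_multiplicity_gt_zero_iff)
      moreover have "multiplicity p D \<le> 1"
        using assms(1) p \<open>D \<noteq> 0\<close> by (simp add: squarefree_factorial_semiring'')
      ultimately show ?thesis by simp
    qed (simp add: not_dvd_imp_multiplicity_0)
  qed
qed simp

text \<open>Each new radicand has a prime factor above all earlier radicands, so its root is new.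
  Avoiding multiples of 3 keeps powers of 3 available as moduli.\<close>

lemma ex_sqrt_independent:
  "\<exists>ps. length ps = n \<and> sqrt_independent ps \<and> (\<forall>a\<in>set ps. \<not> 3 dvd a)"
proof (induction n)
  case (Suc n)
  then obtain ps where ps: "length ps = n" "sqrt_independent ps" "\<forall>a\<in>set ps. \<not> 3 dvd a"
    by blast
  obtain M where M: "\<And>a. a \<in> set ps \<Longrightarrow> a \<le> M"
    using finite_nat_set_iff_bounded_le[of "set ps"] by auto
  obtain D f u p :: nat where D: "squarefree D" "\<not> 3 dvd D" "prime p" "M < p" "p dvd D"
    using ex_negative_pell_radicand[of M] by blast
  have "sqrt (real D) \<notin> multiquadratic_field ps"
  proof (rule sqrt_notin_multiquadratic_field[OF D(3)])
    show "odd (multiplicity p D)" using D by (intro odd_multiplicity_squarefree)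
    show "a = 0 \<or> \<not> p dvd a" if "a \<in> set ps" for a
      using M[OF that] D(4) by (auto dest: dvd_imp_le)
  qed
  then show ?case
    using ps D by (intro exI[of _ "D # ps"]) auto
qed simp

section \<open>Few variables do not suffice\<close>

lemma qf_eval_cong:
  assumes "\<And>i. i < n \<Longrightarrow> x i = y i"
  shows "qf_eval a n x = qf_eval a n y"
  unfolding qf_eval_def using assms by (intro sum.cong refl) auto

lemma qf_eval_scale: "qf_eval a n (\<lambda>i. c * x i) = c\<^sup>2 * qf_eval a n (x :: nat \<Rightarrow> real)"
  unfolding qf_eval_def sum_distrib_left
  by (intro sum.cong refl) (simp add: power2_eq_square mult_ac)

lemma qf_eval_parallelogram:
  fixes x y :: "nat \<Rightarrow> real"
  shows "qf_eval a n (\<lambda>i. x i + y i) + qf_eval a n (\<lambda>i. x i - y i)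
       = 2 * qf_eval a n x + 2 * qf_eval a n y"
  unfolding qf_eval_def sum_distrib_left sum.distrib [symmetric]
  by (intro sum.cong refl) (simp add: algebra_simps)

lemma totally_pos_definite_nonneg:
  assumes "totally_pos_definite K n a" "real_embedding K \<sigma>"
  shows "qf_eval (\<lambda>i j. \<sigma> (a i j)) n x \<ge> 0"
proof (cases "\<exists>i<n. x i \<noteq> 0")
  case True
  then show ?thesis
    using assms by (force simp: totally_pos_definite_def)
next
  case False
  then show ?thesis by (simp add: qf_eval_def)
qed

section \<open>Positivity and trace bounds from a negative Pell equation\<close>

locale negative_pell = real_subfield +
  fixes D f u :: nat
  assumes squarefree_D: "squarefree D" and pell: "f\<^sup>2 * D = u\<^sup>2 + 1"
    and sqrt_D: "sqrt (real D) \<in> K"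
begin

abbreviation "s \<equiv> sqrt (real D)"

text \<open>\<open>\<delta> / D\<close> lies in the codifferent of \<open>K\<close>.\<close>

definition \<alpha> :: "nat \<Rightarrow> real" where
  "\<alpha> r = (s + real r) * (real f * s + real u)"

definition \<delta> :: real where
  "\<delta> = s * (real f * s - real u)"

lemma s_sq: "s * s = real D" by simp

lemma D_pos: "D > 0"
  using squarefree_D by (cases "D = 0") auto

lemma s_pos: "s > 0" using D_pos by simp

lemma real_pell: "(real f * s) * (real f * s) = real u * real u + 1"
proof -
  have "(real f * s) * (real f * s) = real f * real f * (s * s)"
    by (simp add: algebra_simps del: real_sqrt_mult_self)
  also have "\<dots> = real (f\<^sup>2 * D)" by (simp add: power2_eq_square)
  finally show ?thesis unfolding pell by (simp add: power2_eq_square)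
qed

lemma u_less: "real u < real f * s"
proof (rule ccontr)
  assume "\<not> real u < real f * s"
  then have "(real f * s) * (real f * s) \<le> real u * real u"
    using s_pos by (intro mult_mono) auto
  then show False using real_pell by simp
qed

lemma s_int: "s \<in> ring_of_integers K"
  using sqrt_D by (auto simp: ring_of_integers_def)

lemma \<alpha>_int: "\<alpha> r \<in> ring_of_integers K"
  unfolding \<alpha>_def
  by (intro ring_of_integers_mult ring_of_integers_add s_int ring_of_integers_of_nat)

lemma \<delta>_int: "\<delta> \<in> ring_of_integers K"
  unfolding \<delta>_def
  by (intro ring_of_integers_mult ring_of_integers_diff s_int ring_of_integers_of_nat)

lemma real_embedding_s:
  assumes "real_embedding K \<sigma>"
  shows "\<sigma> s = s \<or> \<sigma> s = - s"
proof -
  interpret field_embedding K \<sigma> using assms by (simp add: real_embedding_iff)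
  have "(\<sigma> s)\<^sup>2 = s\<^sup>2" using hom_sqrt[OF sqrt_D] by (simp add: power2_eq_square)
  then show ?thesis by (simp only: power2_eq_iff)
qed

text \<open>The unit \<open>f * s + u\<close> has norm -1: when an embedding negates
  \<open>s\<close>, both factors of \<open>\<alpha> r\<close> become negative, as
  \<open>r < s\<close> and \<open>u < f * s\<close>.\<close>

lemma \<alpha>_totally_positive:
  assumes "r\<^sup>2 < D"
  shows "totally_positive K (\<alpha> r)"
  unfolding totally_positive_def
proof (intro conjI allI impI)
  show "\<alpha> r \<in> K" using \<alpha>_int by (simp add: ring_of_integers_def)
  fix \<sigma> assume \<sigma>: "real_embedding K \<sigma>"
  then interpret field_embedding K \<sigma> by (simp add: real_embedding_iff)
  have r: "real r < s"
    using assms by (intro real_less_rsqrt) (simp flip: of_nat_power)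
  have "\<sigma> (\<alpha> r) = (\<sigma> s + real r) * (real f * \<sigma> s + real u)"
    using sqrt_D by (simp add: \<alpha>_def hom_add hom_mult add_mem mult_mem)
  moreover have "(s + real r) * (real f * s + real u) > 0"
    using s_pos u_less by (intro mult_pos_pos) linarith+
  moreover have "(- s + real r) * (real f * - s + real u) > 0"
    using r u_less by (intro mult_neg_neg) auto
  ultimately show "\<sigma> (\<alpha> r) > 0"
    using real_embedding_s[OF \<sigma>] by auto
qed

text \<open>Again both factors change sign together when \<open>s\<close> is negated.\<close>

lemma \<delta>_positive:
  assumes \<sigma>: "real_embedding K \<sigma>"
  shows "\<sigma> \<delta> > 0"
proof -
  interpret field_embedding K \<sigma> using assms by (simp add: real_embedding_iff)
  have "\<sigma> \<delta> = \<sigma> s * (real f * \<sigma> s - real u)"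
    using sqrt_D by (simp add: \<delta>_def hom_diff hom_mult diff_mem mult_mem)
  moreover have "s * (real f * s - real u) > 0"
    using s_pos u_less by (intro mult_pos_pos) auto
  moreover have "- s * (real f * - s - real u) > 0"
    using s_pos u_less by (intro mult_neg_neg) (auto intro: le_less_trans[of _ 0])
  ultimately show ?thesis
    using real_embedding_s[OF \<sigma>] by auto
qed

text \<open>By the Pell equation the two conjugate unit factors multiply to 1, leaving
  \<open>D + r * s\<close>; then \<open>r \<le> s\<close> bounds every conjugate.\<close>

lemma \<delta>_\<alpha>_le:
  assumes \<sigma>: "real_embedding K \<sigma>" and r: "r\<^sup>2 < D"
  shows "\<sigma> \<delta> * \<sigma> (\<alpha> r) \<le> 2 * real D"
proof -
  interpret field_embedding K \<sigma> using assms by (simp add: real_embedding_iff)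
  have "\<delta> * \<alpha> r = (s * s + real r * s) * ((real f * s) * (real f * s) - real u * real u)"
    by (simp add: \<delta>_def \<alpha>_def algebra_simps del: real_sqrt_mult_self)
  also have "\<dots> = real D + real r * s"
    unfolding real_pell s_sq by simp
  finally have eq: "\<delta> * \<alpha> r = real D + real r * s" .
  have "\<sigma> \<delta> * \<sigma> (\<alpha> r) = \<sigma> (\<delta> * \<alpha> r)"
    using \<delta>_int \<alpha>_int by (simp add: hom_mult ring_of_integers_def)
  also have "\<dots> = real D + real r * \<sigma> s"
    unfolding eq using sqrt_D by (simp add: hom_add hom_mult mult_mem)
  also have "\<dots> \<le> real D + s * s"
  proof -
    have "real r \<le> s"
      using r by (intro real_le_rsqrt) (simp flip: of_nat_power)
    moreover have "\<sigma> s \<le> s" using real_embedding_s[OF \<sigma>] s_pos by auto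
    ultimately have "real r * \<sigma> s \<le> real r * s" "real r * s \<le> s * s"
      using s_pos by (auto intro: mult_left_mono mult_right_mono simp del: real_sqrt_mult_self)
    then show ?thesis by linarith
  qed
  finally show ?thesis by simp
qed

text \<open>The sum \<open>T\<close> is a positive integer, and \<open>T / s\<close> is still an
  algebraic integer. Hence \<open>D\<close> divides \<open>T^2\<close>, and being squarefree it
  divides \<open>T\<close>.\<close>

lemma trace_\<delta>_ge:
  assumes \<tau>: "trace_family K d \<tau>" and "d > 0"
    and g: "g \<in> ring_of_integers K" and pos: "\<And>i. i < d \<Longrightarrow> \<tau> i g > 0"
  shows "real D \<le> (\<Sum>i<d. \<tau> i \<delta> * \<tau> i g)"
proof -
  have emb: "real_embedding K (\<tau> i)" if "i < d" for i
    using that \<tau> by (simp add: trace_family_def)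
  define T where "T = (\<Sum>i<d. \<tau> i \<delta> * \<tau> i g)"
  define h where "h = (real f * s - real u) * g"
  have h: "h \<in> ring_of_integers K"
    unfolding h_def by (intro ring_of_integers_mult ring_of_integers_diff s_int ring_of_integers_of_nat g)
  have sh: "s * h \<in> ring_of_integers K" by (intro ring_of_integers_mult s_int h)
  have T_eq: "T = (\<Sum>i<d. \<tau> i (s * h))"
    unfolding T_def
  proof (intro sum.cong refl)
    fix i assume "i \<in> {..<d}"
    then interpret field_embedding K "\<tau> i" using emb by (simp add: real_embedding_iff)
    have "s * h = \<delta> * g" by (simp add: h_def \<delta>_def)
    then show "\<tau> i \<delta> * \<tau> i g = \<tau> i (s * h)"
      using \<delta>_int g by (simp add: hom_mult ring_of_integers_def)
  qed
  have rat: "T \<in> \<rat>"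
    unfolding T_eq using \<tau> sh by (simp add: trace_family_def ring_of_integers_def)
  have "algebraic_int T"
    unfolding T_eq
  proof (rule algebraic_int_sum)
    fix i assume "i \<in> {..<d}"
    then interpret field_embedding K "\<tau> i" using emb by (simp add: real_embedding_iff)
    show "algebraic_int (\<tau> i (s * h))"
      using sh by (intro hom_algebraic_int) (simp_all add: ring_of_integers_def)
  qed
  with rat have "T \<in> \<int>" by (intro rational_algebraic_int_is_int)
  moreover have "T > 0"
    unfolding T_def using pos emb \<delta>_positive \<open>d > 0\<close> by (intro sum_pos) auto
  ultimately obtain t :: nat where t: "T = real t" "t > 0"
    by (auto elim!: Ints_cases) (metis of_int_of_nat_eq zero_less_imp_eq_int)
  \<comment> \<open>Every embedding sends \<open>s\<close> to \<open>s\<close> or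
    \<open>- s\<close>, so dividing by \<open>s\<close> leaves a signed sum of conjugates of
    \<open>h\<close>.\<close>
  have "T / s = (\<Sum>i<d. \<tau> i s / s * \<tau> i h)"
    unfolding T_eq sum_divide_distrib
  proof (intro sum.cong refl)
    fix i assume "i \<in> {..<d}"
    then interpret field_embedding K "\<tau> i" using emb by (simp add: real_embedding_iff)
    show "\<tau> i (s * h) / s = \<tau> i s / s * \<tau> i h"
      using sqrt_D h by (simp add: hom_mult ring_of_integers_def)
  qed
  moreover have "algebraic_int (\<Sum>i<d. \<tau> i s / s * \<tau> i h)"
  proof (rule algebraic_int_sum)
    fix i assume i: "i \<in> {..<d}"
    then interpret field_embedding K "\<tau> i" using emb by (simp add: real_embedding_iff)
    have "algebraic_int (\<tau> i h)"
      using h by (intro hom_algebraic_int) (simp_all add: ring_of_integers_def)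
    moreover have "\<tau> i s / s = 1 \<or> \<tau> i s / s = - 1"
      using real_embedding_s[of "\<tau> i"] emb i s_pos by auto
    ultimately show "algebraic_int (\<tau> i s / s * \<tau> i h)"
      by (elim disjE) (simp_all only: mult_1_left mult_minus1 algebraic_int_minus_iff)
  qed
  \<comment> \<open>Squaring removes the irrational \<open>s\<close>, so the rational algebraic
    integer \<open>T^2 / D\<close> is an integer.\<close>
  ultimately have "algebraic_int (T / s * (T / s))"
    by (auto intro: algebraic_int_mult)
  moreover have "T / s * (T / s) = T * T / real D"
    using s_sq by simp
  ultimately have "algebraic_int (T * T / real D)" by simp
  moreover have "T * T / real D \<in> \<rat>" using rat by simp
  ultimately have "T * T / real D \<in> \<int>" by (intro rational_algebraic_int_is_int)
  then obtain m where "real t * real t / real D = of_int m"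
    unfolding t(1) by (auto elim!: Ints_cases)
  then have "of_int (int (t\<^sup>2)) = (of_int (int D * m) :: real)"
    using D_pos by (simp add: field_simps power2_eq_square)
  then have "int (t\<^sup>2) = int D * m" by (simp only: of_int_eq_iff)
  then have "int D dvd int (t\<^sup>2)" by simp
  then have "D dvd t\<^sup>2" by (simp only: int_dvd_int_iff)
  then have "D dvd t" by (rule squarefree_dvd_square[OF squarefree_D])
  then have "D \<le> t" using t(2) by (rule dvd_imp_le)
  then show ?thesis using t(1) by (simp add: T_def)
qed

text \<open>The form represents one \<open>\<alpha> r\<close> more than there are residue vectors;
  the difference of two congruent representing vectors is too short for the trace bound.\<close>

lemma no_universal_form:
  assumes \<tau>: "trace_family K d \<tau>" and d: "d > 0"
    and res: "has_residue_map K l c" and l: "8 * d < l\<^sup>2" and c: "(c ^ n)\<^sup>2 < D"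
    and form: "form_over_OK K n a" and tpd: "totally_pos_definite K n a"
    and univ: "universal_form K n a"
  shows False
proof -
  obtain \<phi> :: "real \<Rightarrow> nat" where \<phi>: "\<And>x. x \<in> ring_of_integers K \<Longrightarrow> \<phi> x < c"
    and \<phi>_eqD: "\<And>x y. x \<in> ring_of_integers K \<Longrightarrow> y \<in> ring_of_integers K \<Longrightarrow> \<phi> x = \<phi> y \<Longrightarrow>
      \<exists>w\<in>ring_of_integers K. x - y = real l * w"
    using res unfolding has_residue_map_def by blast
  \<comment> \<open>The range of \<open>r\<close> up to \<open>c ^ n\<close> has
    \<open>c ^ n + 1\<close> members, one more than the \<open>c ^ n\<close> vectors of
    labels.\<close>
  have small: "r\<^sup>2 < D" if "r \<le> c ^ n" for r
    using le_less_trans[OF power_mono[OF that, of 2] c] by simp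
  have "\<forall>r\<in>{..c ^ n}. \<exists>x. (\<forall>i<n. x i \<in> ring_of_integers K) \<and> qf_eval a n x = \<alpha> r"
    using univ \<alpha>_int \<alpha>_totally_positive[OF small] by (simp add: universal_form_def)
  then obtain v where "\<forall>r\<in>{..c ^ n}. (\<forall>i<n. v r i \<in> ring_of_integers K) \<and> qf_eval a n (v r) = \<alpha> r"
    by (rule bchoice[THEN exE])
  then have v: "\<And>r i. r \<le> c ^ n \<Longrightarrow> i < n \<Longrightarrow> v r i \<in> ring_of_integers K"
    and v_eval: "\<And>r. r \<le> c ^ n \<Longrightarrow> qf_eval a n (v r) = \<alpha> r"
    by simp_all
  define F where "F r = map (\<lambda>i. \<phi> (v r i)) [0..<n]" for r
  have "F ` {..c ^ n} \<subseteq> {xs. set xs \<subseteq> {..<c} \<and> length xs = n}"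
    using v \<phi> by (auto simp: F_def)
  then have "card (F ` {..c ^ n}) \<le> card {xs. set xs \<subseteq> {..<c} \<and> length xs = n}"
    by (intro card_mono finite_lists_length_eq) auto
  also have "\<dots> = c ^ n" by (simp add: card_lists_length_eq)
  finally have "\<not> inj_on F {..c ^ n}" by (intro pigeonhole) simp
  then obtain r r' where rr: "r \<le> c ^ n" "r' \<le> c ^ n" "r \<noteq> r'" "F r = F r'"
    by (auto simp: inj_on_def)
  have "\<forall>i\<in>{..<n}. \<exists>w\<in>ring_of_integers K. v r i - v r' i = real l * w"
  proof
    fix i assume i: "i \<in> {..<n}"
    have "F r ! i = F r' ! i" using rr(4) by simp
    then have "\<phi> (v r i) = \<phi> (v r' i)" using i by (simp add: F_def)
    then show "\<exists>w\<in>ring_of_integers K. v r i - v r' i = real l * w"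
      using \<phi>_eqD v rr i by auto
  qed
  then have "\<exists>w. \<forall>i\<in>{..<n}. w i \<in> ring_of_integers K \<and> v r i - v r' i = real l * w i"
    by (intro bchoice) blast
  then obtain w where w: "\<And>i. i < n \<Longrightarrow> w i \<in> ring_of_integers K"
    and vw: "\<And>i. i < n \<Longrightarrow> v r i - v r' i = real l * w i"
    by auto
  \<comment> \<open>If \<open>w\<close> vanished, both vectors would give the same value, but
    \<open>\<alpha>\<close> is injective because \<open>f * s + u\<close> is nonzero.\<close>
  have "\<exists>i<n. w i \<noteq> 0"
  proof (rule ccontr)
    assume "\<not> (\<exists>i<n. w i \<noteq> 0)"
    then have "qf_eval a n (v r) = qf_eval a n (v r')"
      using vw by (intro qf_eval_cong) force
    then have "\<alpha> r = \<alpha> r'" using v_eval rr by simp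
    moreover have "real f * s + real u > 0" using u_less by linarith
    ultimately show False using rr(3) by (simp add: \<alpha>_def)
  qed
  then obtain j where j: "j < n" "w j \<noteq> 0" by blast
  have a_int: "a i k \<in> ring_of_integers K" if "i \<le> k" "k < n" for i k
    using form that by (simp add: form_over_OK_def)
  then have a_mem: "a i k \<in> K" if "i \<le> k" "k < n" for i k
    using that by (simp add: ring_of_integers_def)
  define g where "g = qf_eval a n w"
  have g: "g \<in> ring_of_integers K"
    unfolding g_def qf_eval_def using a_int w
    by (intro ring_of_integers_sum ring_of_integers_mult) auto
  have emb: "real_embedding K (\<tau> i)" if "i < d" for i
    using that \<tau> by (simp add: trace_family_def)
  have *: "\<tau> i g > 0 \<and> (real l)\<^sup>2 * (\<tau> i \<delta> * \<tau> i g) \<le> 8 * real D" if i: "i < d" for i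
  proof -
    let ?Q = "qf_eval (\<lambda>k m. \<tau> i (a k m)) n"
    interpret field_embedding K "\<tau> i" using emb[OF i] by (simp add: real_embedding_iff)
    have eval: "\<tau> i (qf_eval a n x) = ?Q (\<lambda>k. \<tau> i (x k))"
      if "\<And>k. k < n \<Longrightarrow> x k \<in> ring_of_integers K" for x
      using that by (intro hom_qf_eval a_mem) (auto simp: ring_of_integers_def)
    have w_mem: "w k \<in> K" if "k < n" for k using w that by (simp add: ring_of_integers_def)
    have "\<exists>k<n. \<tau> i (w k) \<noteq> 0"
      using hom_nonzero[OF w_mem[OF j(1)] j(2)] j(1) by (intro exI[of _ j] conjI)
    then have "?Q (\<lambda>k. \<tau> i (w k)) > 0"
      using tpd[unfolded totally_pos_definite_def, rule_format, OF emb[OF i]] by simp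
    then have pos: "\<tau> i g > 0"
      unfolding g_def by (subst eval[OF w])
    have "(real l)\<^sup>2 * \<tau> i g = ?Q (\<lambda>k. real l * \<tau> i (w k))"
      unfolding g_def by (subst eval[OF w]) (simp_all add: qf_eval_scale)
    also have "\<dots> = ?Q (\<lambda>k. \<tau> i (v r k) - \<tau> i (v r' k))"
    proof (rule qf_eval_cong)
      fix k assume k: "k < n"
      have "v r k \<in> K" "v r' k \<in> K" using v rr k by (auto simp: ring_of_integers_def)
      then have "\<tau> i (v r k) - \<tau> i (v r' k) = \<tau> i (real l * w k)"
        using vw[OF k] by (simp flip: hom_diff)
      then show "real l * \<tau> i (w k) = \<tau> i (v r k) - \<tau> i (v r' k)"
        using w_mem[OF k] by (simp add: hom_mult)
    qed
    \<comment> \<open>The parallelogram law, with the nonnegative value at the sum of the vectors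
      dropped.\<close>
    also have "\<dots> \<le> 2 * ?Q (\<lambda>k. \<tau> i (v r k)) + 2 * ?Q (\<lambda>k. \<tau> i (v r' k))"
      using qf_eval_parallelogram[of "\<lambda>k m. \<tau> i (a k m)" n "\<lambda>k. \<tau> i (v r k)" "\<lambda>k. \<tau> i (v r' k)"]
        totally_pos_definite_nonneg[OF tpd emb[OF i], of "\<lambda>k. \<tau> i (v r k) + \<tau> i (v r' k)"]
      by linarith
    also have "\<dots> = 2 * \<tau> i (\<alpha> r) + 2 * \<tau> i (\<alpha> r')"
      using eval[of "v r"] eval[of "v r'"] v v_eval rr by simp
    finally have "(real l)\<^sup>2 * \<tau> i g \<le> 2 * \<tau> i (\<alpha> r) + 2 * \<tau> i (\<alpha> r')" .
    then have "\<tau> i \<delta> * ((real l)\<^sup>2 * \<tau> i g) \<le> \<tau> i \<delta> * (2 * \<tau> i (\<alpha> r) + 2 * \<tau> i (\<alpha> r'))"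
      using \<delta>_positive[OF emb[OF i]] by (intro mult_left_mono) auto
    also have "\<dots> = 2 * (\<tau> i \<delta> * \<tau> i (\<alpha> r)) + 2 * (\<tau> i \<delta> * \<tau> i (\<alpha> r'))"
      by (simp add: algebra_simps)
    also have "\<dots> \<le> 8 * real D"
      using \<delta>_\<alpha>_le[OF emb[OF i] small[OF rr(1)]] \<delta>_\<alpha>_le[OF emb[OF i] small[OF rr(2)]] by linarith
    finally show ?thesis using pos by (simp add: mult_ac)
  qed
  \<comment> \<open>Summation over the \<open>d\<close> embeddings gives
    \<open>l^2 * D \<le> 8 * d * D\<close>, against the choice of \<open>l\<close>.\<close>
  have "(real l)\<^sup>2 * real D \<le> (real l)\<^sup>2 * (\<Sum>i<d. \<tau> i \<delta> * \<tau> i g)"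
    using trace_\<delta>_ge[OF \<tau> d g] * by (intro mult_left_mono) auto
  also have "\<dots> = (\<Sum>i<d. (real l)\<^sup>2 * (\<tau> i \<delta> * \<tau> i g))"
    by (rule sum_distrib_left)
  also have "\<dots> \<le> (\<Sum>i<d. 8 * real D)"
    using * by (intro sum_mono) auto
  also have "\<dots> = real (8 * d) * real D" by simp
  finally have "(real l)\<^sup>2 \<le> real (8 * d)"
    using D_pos by simp
  then have "l\<^sup>2 \<le> 8 * d" by (simp only: of_nat_le_iff flip: of_nat_power)
  then show False using l by simp
qed

end

text \<open>Given finitely many such fields, a radicand \<open>D\<close> with a prime factor above
  all their generators yields a field of the same kind that is not among them.\<close>

theorem theorem1:
  fixes k N :: nat
  assumes "k \<ge> 1" and "N \<ge> 1"
  shows "infinite {K. is_multiquadratic K \<and> totally_real K \<and> has_degree K (2 ^ k) \<and>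
           (\<forall>n a. form_over_OK K n a \<and> totally_pos_definite K n a \<and> universal_form K n a
                    \<longrightarrow> N \<le> n)}"
proof
  define S where "S = {K. is_multiquadratic K \<and> totally_real K \<and> has_degree K (2 ^ k) \<and>
           (\<forall>n a. form_over_OK K n a \<and> totally_pos_definite K n a \<and> universal_form K n a
                    \<longrightarrow> N \<le> n)}"
  assume "finite {K. is_multiquadratic K \<and> totally_real K \<and> has_degree K (2 ^ k) \<and>
           (\<forall>n a. form_over_OK K n a \<and> totally_pos_definite K n a \<and> universal_form K n a
                    \<longrightarrow> N \<le> n)}"
  then have fin: "finite S" by (simp only: S_def)
  have "\<forall>K\<in>S. \<exists>ps. K = multiquadratic_field ps"
    by (auto simp: S_def is_multiquadratic_def)
  then have "\<exists>gens. \<forall>K\<in>S. K = multiquadratic_field (gens K)"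
    by (rule bchoice)
  then obtain gens where gens: "\<And>K. K \<in> S \<Longrightarrow> K = multiquadratic_field (gens K)"
    by blast
  \<comment> \<open>These \<open>k - 1\<close> radicands stay fixed; \<open>D\<close> is the last
    one and varies.\<close>
  obtain qs where qs: "length qs = k - 1" "sqrt_independent qs" "\<forall>q\<in>set qs. \<not> 3 dvd q"
    using ex_sqrt_independent by blast
  define d :: nat where "d = 2 ^ k"
  \<comment> \<open>The exponent is a simple way to ensure \<open>8 * d < l\<close>.\<close>
  define l :: nat where "l = 3 ^ (8 * d)"
  define c where "c = l ^ d"
  \<comment> \<open>\<open>M\<close> bounds the generators of all fields in \<open>S\<close>, the
    fixed radicands, and the threshold that \<open>D\<close> must exceed in
    \<open>no_universal_form\<close>.\<close>
  have "finite ((\<Union>K\<in>S. set (gens K)) \<union> set qs \<union> {(c ^ N)\<^sup>2})"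
    using fin by simp
  then obtain M where M: "\<forall>x\<in>(\<Union>K\<in>S. set (gens K)) \<union> set qs \<union> {(c ^ N)\<^sup>2}. x \<le> M"
    unfolding finite_nat_set_iff_bounded_le by blast
  obtain D f u p :: nat where D: "squarefree D" "f\<^sup>2 * D = u\<^sup>2 + 1" "\<not> 3 dvd D"
    "prime p" "M < p" "p dvd D"
    using ex_negative_pell_radicand[of M] by blast
  have notin: "sqrt (real D) \<notin> multiquadratic_field ps" if "\<forall>a\<in>set ps. a \<le> M" for ps
  proof (rule sqrt_notin_multiquadratic_field[OF D(4)])
    show "odd (multiplicity p D)" using D by (intro odd_multiplicity_squarefree)
    show "a = 0 \<or> \<not> p dvd a" if "a \<in> set ps" for a
      using that \<open>\<forall>a\<in>set ps. a \<le> M\<close> D(5) by (auto dest!: dvd_imp_le)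
  qed
  let ?K = "multiquadratic_field (D # qs)"
  have sqrt_mem: "sqrt (real D) \<in> ?K"
    by (rule sqrt_mem_multiquadratic_field) simp
  have indep: "sqrt_independent (D # qs)"
    using notin[of qs] M qs(2) by auto
  have len: "2 ^ length (D # qs) = d"
    using qs(1) assms(1) by (simp add: d_def flip: power_Suc)
  interpret negative_pell ?K D f u
    using real_subfield_multiquadratic_field[of "D # qs"] D sqrt_mem
    by (simp add: negative_pell_def negative_pell_axioms_def)
  obtain \<tau> where \<tau>: "trace_family ?K d \<tau>"
    using trace_family_multiquadratic_field[OF indep] len by auto
  have "has_residue_map ?K l (l ^ 2 ^ length (D # qs))"
  proof (rule has_residue_map_multiquadratic_field[OF _ indep])
    show "l > 0" by (simp add: l_def)
    fix q assume "q \<in> set (D # qs)"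
    then have "\<not> 3 dvd q" using qs(3) D(3) by auto
    then have "\<not> 3 dvd 2 * q" by (simp add: prime_dvd_mult_iff)
    then have "coprime 3 (2 * q)" by (intro prime_imp_coprime) simp_all
    then show "coprime l (2 * q)" by (simp only: l_def coprime_power_left_iff simp_thms)
  qed
  then have res: "has_residue_map ?K l c" by (simp only: len c_def)
  have "8 * d < l" unfolding l_def by (rule power_gt_expt) simp
  moreover have "l \<le> l\<^sup>2" by (simp add: power2_eq_square)
  ultimately have l: "8 * d < l\<^sup>2" by simp
  have "N \<le> n"
    if "form_over_OK ?K n a" "totally_pos_definite ?K n a" "universal_form ?K n a" for n a
  \<comment> \<open>With fewer than \<open>N\<close> variables the number of residue vectors is at
    most \<open>c ^ N\<close>, and its square is below \<open>D\<close> because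
    \<open>M < p \<le> D\<close>.\<close>
  proof (rule ccontr)
    assume "\<not> N \<le> n"
    have "c \<ge> 1" by (simp add: c_def l_def)
    then have "(c ^ n)\<^sup>2 \<le> (c ^ N)\<^sup>2"
      using \<open>\<not> N \<le> n\<close> by (intro power_mono power_increasing) auto
    also have "\<dots> < D"
      using M D(5) dvd_imp_le[OF D(6) D_pos] by auto
    finally show False
      using no_universal_form[OF \<tau> _ res l] that by (simp add: d_def)
  qed
  then have "?K \<in> S"
    using totally_real_multiquadratic_field has_degree_multiquadratic_field[OF indep, unfolded len]
    unfolding S_def is_multiquadratic_def d_def by auto
  \<comment> \<open>The list chosen for the new field as a member of \<open>S\<close> is bounded by
    \<open>M\<close>, so the field it generates misses \<open>sqrt D\<close>, although it equals
    \<open>?K\<close>.\<close>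
  then have "sqrt (real D) \<notin> multiquadratic_field (gens ?K)"
    using M by (intro notin) blast
  then show False
    using gens[OF \<open>?K \<in> S\<close>] sqrt_mem by simp
qed

end
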